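(* There exists a unique $U^\vee_q$-module structure on $V$ for which the generators $z,Z,A$ of $U^\vee_q$ act on $V$ as $K$, $B$, $\mathbf{A}$, respectively. On this $U^\vee_q$-module $V$ the elements $x$, $X$, $y^{-1}$ act as $$a\mathbf{A}-a^2K,\qquad a^{-1}\mathbf{A}-a^{-2}B,\qquad \frac{aK-a^{-1}B}{a-a^{-1}},$$ respectively.
   Context: $\mathbb{F}$ is a field and $q\in\mathbb{F}$ is nonzero with $q^4\neq 1$. Tridiagonal pairs. Let $V$ be an $\mathbb{F}$-vector space of finite positive dimension. A tridiagonal pair on $V$ is an ordered pair of $\mathbb{F}$-linear maps $\mathbf{A},\mathbf{A}^*:V\to V$ such that: (i) each of $\mathbf{A},\mathbf{A}^*$ is diagonalizable; (ii) there is an ordering $\{V_i\}_{i=0}^d$ of the eigenspaces of $\mathbf{A}$ with $\mathbf{A}^*V_i\subseteq V_{i-1}+V_i+V_{i+1}$ for $0\le i\le d$ ($V_{-1}=V_{d+1}=0$); (iii) there is an ordering $\{V^*_i\}_{i=0}^\delta$ of the eigenspaces of $\mathbf{A}^*$ with $\mathbf{A}V^*_i\subseteq V^*_{i-1}+V^*_i+V^*_{i+1}$ for $0\le i\le\delta$ ($V^*_{-1}=V^*_{\delta+1}=0$); (iv) there is no subspace $W\subseteq V$ with $\mathbf{A}W\subseteq W$, $\mathbf{A}^*W\subseteq W$, $W\neq0$, $W\neq V$. It is known that $d=\delta$ (the diameter). Fix a tridiagonal pair $\mathbf{A},\mathbf{A}^*$ on $V$ with $d\ge1$, fix orderings $\{V_i\}_{i=0}^d$,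 $\{V^*_i\}_{i=0}^d$ satisfying (ii), (iii), and let $\theta_i,\theta^*_i$ be the eigenvalues of $\mathbf{A},\mathbf{A}^*$ for $V_i,V^*_i$. Assume the pair has $q$-Racah type: there exist nonzero $a,b\in\mathbb{F}$ with $\theta_i=aq^{d-2i}+a^{-1}q^{2i-d}$ and $\theta^*_i=bq^{d-2i}+b^{-1}q^{2i-d}$ for $0\le i\le d$; fix these (then $a^2\neq1$). For $0\le i\le d$ let $$U_i=(V^*_0+\cdots+V^*_i)\cap(V_i+\cdots+V_d),\qquad U^\Downarrow_i=(V^*_0+\cdots+V^*_i)\cap(V_0+\cdots+V_{d-i}).$$ It is known that $V=\sum_{i=0}^dU_i$ and $V=\sum_{i=0}^dU^\Downarrow_i$ are direct sums. $K:V\to V$ (resp. $B:V\to V$) is the $\mathbb{F}$-linear map acting on $U_i$ (resp. $U^\Downarrow_i$) as $q^{d-2i}$ times the identity, for $0\le i\le d$. The algebra. $U_q(\mathfrak{sl}_2)$ is the $\mathbb{F}$-algebra with generators $x,y^{\pm1},z$ and relations $yy^{-1}=y^{-1}y=1$, $\frac{qxy-q^{-1}yx}{q-q^{-1}}=\frac{qyz-q^{-1}zy}{q-q^{-1}}=\frac{qzx-q^{-1}xz}{q-q^{-1}}=1$. $U^\vee_q$ is its (unital) subalgebra generated by $x,y^{-1},z$. With $a\in\mathbb{F}$ the fixed nonzero scalar satisfying $\theta_i=aq^{d-2i}+a^{-1}q^{2i-d}$ for $0\le i\le d$, set $X=a^{-2}x+(1-a^{-2})y^{-1}$, $Z=a^2z+(1-a^2)y^{-1}$,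 $A=a^{-1}x+az=aX+a^{-1}Z$; these lie in $U^\vee_q$. *)

theory Defs
  imports
    "HOL-Library.Poly_Mapping"
    "HOL-Algebra.QuotRing"
    "HOL-Algebra.Generated_Rings"
    "HOL-Algebra.Algebraic_Closure_Type"
begin

section \<open>Tridiagonal pairs\<close>

text \<open>
  A vector space is given by a type \<open>'v\<close> and a scalar multiplication \<open>scale\<close>, as in the locale
  \<^locale>\<open>vector_space\<close>.
\<close>

definition eigenspace :: "('f::field \<Rightarrow> 'v::ab_group_add \<Rightarrow> 'v) \<Rightarrow> ('v \<Rightarrow> 'v) \<Rightarrow> 'f \<Rightarrow> 'v set" where
  "eigenspace scale f t = {v. f v = scale t v}"

definition eigenspaces :: "('f::field \<Rightarrow> 'v::ab_group_add \<Rightarrow> 'v) \<Rightarrow> ('v \<Rightarrow> 'v) \<Rightarrow> 'v set set" where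
  "eigenspaces scale f = {eigenspace scale f t | t. eigenspace scale f t \<noteq> {0}}"

definition diagonalizable :: "('f::field \<Rightarrow> 'v::ab_group_add \<Rightarrow> 'v) \<Rightarrow> ('v \<Rightarrow> 'v) \<Rightarrow> bool" where
  "diagonalizable scale f \<longleftrightarrow>
     (\<exists>Bs. \<not> module.dependent scale Bs \<and> module.span scale Bs = UNIV \<and>
        (\<forall>v\<in>Bs. \<exists>t. f v = scale t v))"

text \<open>The sum of a family of subspaces is the span of their union.\<close>

definition subspace_sum ::
  "('f::field \<Rightarrow> 'v::ab_group_add \<Rightarrow> 'v) \<Rightarrow> (nat \<Rightarrow> 'v set) \<Rightarrow> nat set \<Rightarrow> 'v set" where
  "subspace_sum scale V I = module.span scale (\<Union>i\<in>I. V i)"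

text \<open>
  \<open>V 0, \<dots>, V d\<close> lists the eigenspaces of \<open>A\<close> without repetition, and \<open>As\<close> maps \<open>V i\<close> into
  \<open>V (i - 1) + V i + V (i + 1)\<close>. Restricting the indices \<open>j\<close> to \<open>{0..d}\<close> amounts to the
  convention that the spaces with index \<open>-1\<close> and \<open>d + 1\<close> are zero.
\<close>

definition tridiagonal_ordering ::
  "('f::field \<Rightarrow> 'v::ab_group_add \<Rightarrow> 'v) \<Rightarrow> ('v \<Rightarrow> 'v) \<Rightarrow> ('v \<Rightarrow> 'v) \<Rightarrow> nat \<Rightarrow> (nat \<Rightarrow> 'v set) \<Rightarrow> bool" where
  "tridiagonal_ordering scale A As d V \<longleftrightarrow>
     bij_betw V {0..d} (eigenspaces scale A) \<and>
     (\<forall>i\<le>d. As ` V i \<subseteq> subspace_sum scale V {j. j \<le> d \<and> i \<le> j + 1 \<and> j \<le> i + 1})"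

definition tridiagonal_pair ::
  "('f::field \<Rightarrow> 'v::ab_group_add \<Rightarrow> 'v) \<Rightarrow> ('v \<Rightarrow> 'v) \<Rightarrow> ('v \<Rightarrow> 'v) \<Rightarrow> bool" where
  "tridiagonal_pair scale A As \<longleftrightarrow>
     Vector_Spaces.linear scale scale A \<and> Vector_Spaces.linear scale scale As \<and>
     diagonalizable scale A \<and> diagonalizable scale As \<and>
     (\<exists>d V. tridiagonal_ordering scale A As d V) \<and>
     (\<exists>\<delta> Vs. tridiagonal_ordering scale As A \<delta> Vs) \<and>
     \<not> (\<exists>W. module.subspace scale W \<and> A ` W \<subseteq> W \<and> As ` W \<subseteq> W \<and> W \<noteq> {0} \<and> W \<noteq> UNIV)"

definition split_U ::
  "('f::field \<Rightarrow> 'v::ab_group_add \<Rightarrow> 'v) \<Rightarrow> nat \<Rightarrow> (nat \<Rightarrow> 'v set) \<Rightarrow> (nat \<Rightarrow> 'v set) \<Rightarrow> nat \<Rightarrow> 'v set" where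
  "split_U scale d V Vs i = subspace_sum scale Vs {0..i} \<inter> subspace_sum scale V {i..d}"

definition split_U_down ::
  "('f::field \<Rightarrow> 'v::ab_group_add \<Rightarrow> 'v) \<Rightarrow> nat \<Rightarrow> (nat \<Rightarrow> 'v set) \<Rightarrow> (nat \<Rightarrow> 'v set) \<Rightarrow> nat \<Rightarrow> 'v set" where
  "split_U_down scale d V Vs i = subspace_sum scale Vs {0..i} \<inter> subspace_sum scale V {0..d - i}"


section \<open>The free algebra on a set of generators\<close>

text \<open>
  Words form a monoid under concatenation, written additively so that finitely supported functions
  on words, with the convolution product of \<^theory>\<open>HOL-Library.Poly_Mapping\<close>, are the free
  associative unital algebra.
\<close>

datatype 'g fword = FWord (letters: "'g list")

instantiation fword :: (type) monoid_add
begin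

definition zero_fword :: "'g fword" where
  "zero_fword = FWord []"

definition plus_fword :: "'g fword \<Rightarrow> 'g fword \<Rightarrow> 'g fword" where
  "plus_fword u v = FWord (letters u @ letters v)"

instance
  by standard (simp_all add: zero_fword_def plus_fword_def)

end

type_synonym ('g, 'f) free_algebra = "'g fword \<Rightarrow>\<^sub>0 'f"

definition free_gen :: "'g \<Rightarrow> ('g, 'f::field) free_algebra" where
  "free_gen g = Poly_Mapping.single (FWord [g]) 1"

definition free_scalar :: "'f::field \<Rightarrow> ('g, 'f) free_algebra" where
  "free_scalar c = Poly_Mapping.single 0 c"


section \<open>The algebra \<open>U\<^sub>q(sl\<^sub>2)\<close> in the equitable presentation\<close>

datatype uq_gen = Gx | Gy | Gyinv | Gz

definition uq_relators :: "'f::field \<Rightarrow> (uq_gen, 'f) free_algebra set" where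
  "uq_relators q =
     (let x = free_gen Gx; y = free_gen Gy; yinv = free_gen Gyinv; z = free_gen Gz;
          qcomm = (\<lambda>u v. free_scalar (inverse (q - inverse q)) *
                     (free_scalar q * u * v - free_scalar (inverse q) * v * u))
      in {y * yinv - 1, yinv * y - 1, qcomm x y - 1, qcomm y z - 1, qcomm z x - 1})"

definition uq_ideal :: "'f::field \<Rightarrow> (uq_gen, 'f) free_algebra set" where
  "uq_ideal q = Idl\<^bsub>ring_of_type_algebra\<^esub> (uq_relators q)"

definition uq :: "'f::field \<Rightarrow> (uq_gen, 'f) free_algebra set ring" where
  "uq q = ring_of_type_algebra Quot uq_ideal q"

definition uq_class :: "'f::field \<Rightarrow> (uq_gen, 'f) free_algebra \<Rightarrow> (uq_gen, 'f) free_algebra set" where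
  "uq_class q p = uq_ideal q +>\<^bsub>ring_of_type_algebra\<^esub> p"

definition uq_scalar :: "'f::field \<Rightarrow> 'f \<Rightarrow> (uq_gen, 'f) free_algebra set" where
  "uq_scalar q c = uq_class q (free_scalar c)"

definition uq_smult ::
  "'f::field \<Rightarrow> 'f \<Rightarrow> (uq_gen, 'f) free_algebra set \<Rightarrow> (uq_gen, 'f) free_algebra set" where
  "uq_smult q c u = uq_scalar q c \<otimes>\<^bsub>uq q\<^esub> u"

definition uq_x :: "'f::field \<Rightarrow> (uq_gen, 'f) free_algebra set" where
  "uq_x q = uq_class q (free_gen Gx)"

definition uq_yinv :: "'f::field \<Rightarrow> (uq_gen, 'f) free_algebra set" where
  "uq_yinv q = uq_class q (free_gen Gyinv)"

definition uq_z :: "'f::field \<Rightarrow> (uq_gen, 'f) free_algebra set" where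
  "uq_z q = uq_class q (free_gen Gz)"

text \<open>
  The unital \<open>F\<close>-subalgebra generated by \<open>x\<close>, \<open>y\<inverse>\<close>, \<open>z\<close> is the subring generated by these elements
  together with the scalars.
\<close>

definition uq_vee :: "'f::field \<Rightarrow> (uq_gen, 'f) free_algebra set set" where
  "uq_vee q = generate_ring (uq q) (range (uq_scalar q) \<union> {uq_x q, uq_yinv q, uq_z q})"

definition uq_X :: "'f::field \<Rightarrow> 'f \<Rightarrow> (uq_gen, 'f) free_algebra set" where
  "uq_X q a = uq_smult q (inverse (a^2)) (uq_x q) \<oplus>\<^bsub>uq q\<^esub> uq_smult q (1 - inverse (a^2)) (uq_yinv q)"

definition uq_Z :: "'f::field \<Rightarrow> 'f \<Rightarrow> (uq_gen, 'f) free_algebra set" where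
  "uq_Z q a = uq_smult q (a^2) (uq_z q) \<oplus>\<^bsub>uq q\<^esub> uq_smult q (1 - a^2) (uq_yinv q)"

definition uq_A :: "'f::field \<Rightarrow> 'f \<Rightarrow> (uq_gen, 'f) free_algebra set" where
  "uq_A q a = uq_smult q (inverse a) (uq_x q) \<oplus>\<^bsub>uq q\<^esub> uq_smult q a (uq_z q)"

text \<open>
  A module structure for the algebra \<open>uq_vee q\<close> on the given \<open>F\<close>-vector space, compatible with its
  scalar multiplication. Since an action is a function on the carrier \<open>uq_vee q\<close> only, it is required
  to be \<^const>\<open>extensional\<close>, so that equality of functions is equality of module structures.
\<close>

definition uq_vee_module_structure ::
  "'f::field \<Rightarrow> ('f \<Rightarrow> 'v::ab_group_add \<Rightarrow> 'v) \<Rightarrow> ((uq_gen, 'f) free_algebra set \<Rightarrow> 'v \<Rightarrow> 'v) \<Rightarrow> bool" where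
  "uq_vee_module_structure q scale act \<longleftrightarrow>
     act \<in> extensional (uq_vee q) \<and>
     (\<forall>u\<in>uq_vee q. Vector_Spaces.linear scale scale (act u)) \<and>
     (\<forall>u\<in>uq_vee q. \<forall>u'\<in>uq_vee q. \<forall>v. act (u \<oplus>\<^bsub>uq q\<^esub> u') v = act u v + act u' v) \<and>
     (\<forall>u\<in>uq_vee q. \<forall>u'\<in>uq_vee q. \<forall>v. act (u \<otimes>\<^bsub>uq q\<^esub> u') v = act u (act u' v)) \<and>
     (\<forall>c. \<forall>u\<in>uq_vee q. \<forall>v. act (uq_smult q c u) v = scale c (act u v)) \<and>
     (\<forall>v. act \<one>\<^bsub>uq q\<^esub> v = v)"

end

(*
  Put p = q^(-2), w = (aK - B/a)/(a - 1/a), z = K and x = aA - a^2 K.  The eigenspaces of A* form a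
  flag on whose successive quotients K and B act by the same nonzero scalars q^(d-2i).  So w is
  triangular with nonzero diagonal, hence invertible, and V is even a module for all of U_q(sl_2)
  with y acting as the inverse of w, as soon as x, w, z satisfy three relations.

  The relation between z and x, and its analogue for Z = B and X = A/a - B/a^2, follow from
  (A - theta_i) U_i <= U_(i+1).  Together they show that the defects
  G = zw - p wz - (1-p) w^2 and H = wx - p xw - (1-p) w^2 are proportional, so it suffices that G = 0.
  Resolving z w x in two ways expresses G x through G, H, x, z, w in such a way that G (A u) = 0 once
  G vanishes on an invariant subspace of K and B that contains u.  Moreover G vanishes on the
  intersection of U_i and U_i^down, where K and B are the same scalar.  Since
  (A - theta_k) ... (A - theta_(d-k-1)) maps U_k onto U_(d-k), every U_(i+1) equals
  (A - theta_i) U_i + (U_(i+1) Int U_(i+1)^down), and G = 0 follows by induction along the flag.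
*)

theory Submission
  imports Defs
begin

section \<open>Eigenspace decompositions\<close>

context vector_space
begin

lemma subspace_subspace_sum: "subspace (subspace_sum scale U I)"
  by (simp add: subspace_sum_def subspace_span)

lemma subspace_sum_mono: "I \<subseteq> J \<Longrightarrow> subspace_sum scale U I \<subseteq> subspace_sum scale U J"
  unfolding subspace_sum_def by (intro span_mono) auto

lemma subspace_sum_Un:
  "subspace_sum scale U (I \<union> J) = {x + y |x y. x \<in> subspace_sum scale U I \<and> y \<in> subspace_sum scale U J}"
  unfolding subspace_sum_def UN_Un span_Un ..

lemma subspace_sum_empty: "subspace_sum scale U {} = {0}"
  by (simp add: subspace_sum_def)

lemma mem_subspace_sum: "i \<in> I \<Longrightarrow> v \<in> U i \<Longrightarrow> v \<in> subspace_sum scale U I"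
  unfolding subspace_sum_def by (rule span_base) auto

lemma linear_maps_subspace_sum:
  assumes "Vector_Spaces.linear scale scale f"
    and "\<And>i v. i \<in> I \<Longrightarrow> v \<in> U i \<Longrightarrow> f v \<in> subspace_sum scale U' J"
    and "v \<in> subspace_sum scale U I"
  shows "f v \<in> subspace_sum scale U' J"
proof -
  interpret f: Vector_Spaces.linear scale scale f by fact
  have "subspace {v. f v \<in> subspace_sum scale U' J}"
    by (rule f.subspace_linear_preimage) (rule subspace_subspace_sum)
  then have "span (\<Union>i\<in>I. U i) \<subseteq> {v. f v \<in> subspace_sum scale U' J}"
    using assms(2) by (intro span_minimal) auto
  then show ?thesis using assms(3) by (auto simp: subspace_sum_def)
qed

text \<open>On a split component a map acts as a scalar plus a map into a neighbouring component.
  The scalar multiple stays in the component, so only the remainder has to be checked.\<close>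

lemma subspace_sum_invariant:
  assumes lin: "Vector_Spaces.linear scale scale f"
    and maps: "\<And>i v. i \<in> I \<Longrightarrow> v \<in> U i \<Longrightarrow> \<exists>c. f v - scale c v \<in> subspace_sum scale U I"
  shows "f ` subspace_sum scale U I \<subseteq> subspace_sum scale U I"
proof clarify
  fix v assume v: "v \<in> subspace_sum scale U I"
  show "f v \<in> subspace_sum scale U I"
  proof (rule linear_maps_subspace_sum[OF lin _ v])
    fix i u assume u: "i \<in> I" "u \<in> U i"
    obtain c where "f u - scale c u \<in> subspace_sum scale U I" using maps[OF u] by auto
    moreover have "scale c u \<in> subspace_sum scale U I"
      using mem_subspace_sum[of i I u U] u by (auto intro: subspace_scale subspace_subspace_sum)
    ultimately show "f u \<in> subspace_sum scale U I"
      using subspace_add[OF subspace_subspace_sum] by fastforce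
  qed
qed

end

locale eigenspace_decomposition =
  vector_space scale + lin: Vector_Spaces.linear scale scale A
  for scale :: "'f::field \<Rightarrow> 'v::ab_group_add \<Rightarrow> 'v" and A :: "'v \<Rightarrow> 'v" +
  fixes d :: nat and V :: "nat \<Rightarrow> 'v set" and \<theta> :: "nat \<Rightarrow> 'f"
  assumes inj_eigenvalues: "inj_on \<theta> {0..d}"
    and eigenspaces_eq: "i \<le> d \<Longrightarrow> V i = eigenspace scale A (\<theta> i)"
    and decomposition: "subspace_sum scale V {0..d} = UNIV"
begin

lemma mem_eigenspace: "i \<le> d \<Longrightarrow> v \<in> V i \<longleftrightarrow> A v = scale (\<theta> i) v"
  by (simp add: eigenspaces_eq eigenspace_def)

lemma linear_sub_eigenvalue: "Vector_Spaces.linear scale scale (\<lambda>v. A v - scale c v)"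
  by unfold_locales (auto simp: lin.add lin.scale algebra_simps scale_left_commute)

text \<open>The map \<open>A - \<theta> i\<close> kills \<open>V i\<close> and acts on every other
  \<open>V j\<close> as the scalar \<open>\<theta> j - \<theta> i\<close>, so the index
  \<open>i\<close> drops out.\<close>

lemma eigen_shift:
  assumes "I \<subseteq> {0..d}" "i \<le> d" "v \<in> subspace_sum scale V I"
  shows "A v - scale (\<theta> i) v \<in> subspace_sum scale V (I - {i})"
proof (rule linear_maps_subspace_sum[OF linear_sub_eigenvalue _ assms(3)])
  fix j u assume j: "j \<in> I" "u \<in> V j"
  show "A u - scale (\<theta> i) u \<in> subspace_sum scale V (I - {i})"
  proof (cases "j = i")
    case True
    then show ?thesis using j assms mem_eigenspace[of i u] subspace_0[OF subspace_subspace_sum] by auto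
  next
    case False
    then have "u \<in> subspace_sum scale V (I - {i})" using j by (intro mem_subspace_sum[of j]) auto
    moreover have "A u - scale (\<theta> i) u = scale (\<theta> j - \<theta> i) u"
      using j assms mem_eigenspace[of j u] by (auto simp: scale_left_diff_distrib)
    ultimately show ?thesis by (simp add: subspace_scale[OF subspace_subspace_sum])
  qed
qed

lemma eigen_invariant:
  assumes "I \<subseteq> {0..d}" "v \<in> subspace_sum scale V I"
  shows "A v \<in> subspace_sum scale V I"
proof (rule linear_maps_subspace_sum[OF lin.linear_axioms _ assms(2)])
  fix j u assume j: "j \<in> I" "u \<in> V j"
  then show "A u \<in> subspace_sum scale V I"
    using assms(1) mem_eigenspace[of j u] mem_subspace_sum[of j I u V]
    by (auto simp: subspace_scale[OF subspace_subspace_sum])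
qed

text \<open>Induction on \<open>I\<close>: applying \<open>A - \<theta> i\<close> removes
  \<open>i\<close> from the sum and only multiplies \<open>v\<close> by the nonzero scalar
  \<open>\<theta> j - \<theta> i\<close>.\<close>

lemma eigenvector_not_in_sum:
  assumes "I \<subseteq> {0..d}" "j \<le> d" "j \<notin> I" "v \<in> subspace_sum scale V I" "A v = scale (\<theta> j) v"
  shows "v = 0"
proof -
  have "finite I" using assms(1) finite_subset by blast
  then show ?thesis using assms
  proof (induction I)
    case empty
    then show ?case by (simp add: subspace_sum_empty)
  next
    case (insert i I)
    have "A v - scale (\<theta> i) v \<in> subspace_sum scale V (insert i I - {i})"
      using insert.prems by (intro eigen_shift) auto
    then have "scale (\<theta> j - \<theta> i) v \<in> subspace_sum scale V I"
      using insert.hyps insert.prems by (simp add: scale_left_diff_distrib)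
    then have "scale (inverse (\<theta> j - \<theta> i)) (scale (\<theta> j - \<theta> i) v) \<in> subspace_sum scale V I"
      by (rule subspace_scale[OF subspace_subspace_sum])
    moreover have "\<theta> j \<noteq> \<theta> i"
      using inj_eigenvalues insert.prems by (auto simp: inj_on_def)
    ultimately have "v \<in> subspace_sum scale V I" by simp
    then show ?case using insert by auto
  qed
qed

text \<open>Induction on \<open>J\<close>: \<open>A - \<theta> j\<close> preserves the sum over
  \<open>I\<close> and removes \<open>j\<close> from the other one, so it kills \<open>v\<close>.
  Then \<open>v\<close> is an eigenvector for an index outside \<open>I\<close>.\<close>

lemma eigen_sums_disjoint:
  assumes "I \<subseteq> {0..d}" "J \<subseteq> {0..d}" "I \<inter> J = {}"
    and "v \<in> subspace_sum scale V I" "v \<in> subspace_sum scale V J"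
  shows "v = 0"
proof -
  have "finite J" using assms(2) finite_subset by blast
  then show ?thesis using assms(2-)
  proof (induction J arbitrary: v)
    case empty
    then show ?case by (simp add: subspace_sum_empty)
  next
    case (insert j J)
    have "A v - scale (\<theta> j) v \<in> subspace_sum scale V (insert j J - {j})"
      using insert.prems by (intro eigen_shift) auto
    moreover have "A v - scale (\<theta> j) v \<in> subspace_sum scale V (I - {j})"
      using insert.prems assms(1) by (intro eigen_shift) auto
    moreover have "I - {j} = I" "insert j J - {j} = J" using insert by auto
    ultimately have "A v - scale (\<theta> j) v = 0"
        using insert.prems by (intro insert.IH) auto
    then have "A v = scale (\<theta> j) v" by simp
    then show ?case
      using insert.prems assms(1) by (intro eigenvector_not_in_sum[of I j v]) auto
  qed
qed

text \<open>A converse of \<open>eigen_shift\<close>: for \<open>j < m\<close> the map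
  \<open>A - \<theta> j\<close> is injective on the complementary sum over \<open>{m..d}\<close>, so
  the component of \<open>v\<close> there must vanish.\<close>

lemma mem_sum_of_shift_mem:
  assumes "j < m" "m \<le> Suc d" "A v - scale (\<theta> j) v \<in> subspace_sum scale V {..<m}"
  shows "v \<in> subspace_sum scale V {..<m}"
proof -
  have "{0..d} = {..<m} \<union> {m..d}" using assms(2) by auto
  then have "v \<in> {x + y |x y. x \<in> subspace_sum scale V {..<m} \<and> y \<in> subspace_sum scale V {m..d}}"
    using subspace_sum_Un[of V "{..<m}" "{m..d}"] decomposition by simp
  then obtain x y where xy: "x \<in> subspace_sum scale V {..<m}" "y \<in> subspace_sum scale V {m..d}" "v = x + y"
    by auto
  have sub: "{..<m} \<subseteq> {0..d}" "{m..d} \<subseteq> {0..d}" using assms(2) by auto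
  have "A y - scale (\<theta> j) y = (A v - scale (\<theta> j) v) - (A x - scale (\<theta> j) x)"
    by (simp add: xy(3) lin.add scale_right_distrib)
  moreover have "A x - scale (\<theta> j) x \<in> subspace_sum scale V {..<m}"
    by (intro subspace_diff subspace_scale subspace_subspace_sum eigen_invariant sub xy)
  ultimately have "A y - scale (\<theta> j) y \<in> subspace_sum scale V {..<m}"
    using assms(3) subspace_diff[OF subspace_subspace_sum] by simp
  moreover have "A y - scale (\<theta> j) y \<in> subspace_sum scale V {m..d}"
    by (intro subspace_diff subspace_scale subspace_subspace_sum eigen_invariant sub xy)
  ultimately have "A y - scale (\<theta> j) y = 0"
    by (intro eigen_sums_disjoint[OF sub]) auto
  then have "A y = scale (\<theta> j) y" by simp
  then have "y = 0"
    using assms(1,2) by (intro eigenvector_not_in_sum[OF sub(2) _ _ xy(2), of j]) auto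
  then show ?thesis using xy by simp
qed

end

section \<open>The split decompositions of a tridiagonal pair\<close>

text \<open>The eigenvalues are kept arbitrary, so that reversing the order of the
  \<open>V i\<close> gives another instance of the locale, in which \<open>U\<close> becomes
  \<open>U_down\<close>.\<close>

locale td_split =
  finite_dimensional_vector_space scale Basis +
  E: eigenspace_decomposition scale A d V \<theta> +
  Es: eigenspace_decomposition scale As d Vs \<theta>s
  for scale :: "'f::field \<Rightarrow> 'v::ab_group_add \<Rightarrow> 'v"
    and Basis A As d V Vs \<theta> \<theta>s +
  assumes tridiagonal: "i \<le> d \<Longrightarrow> v \<in> V i \<Longrightarrow>
      As v \<in> subspace_sum scale V {j. j \<le> d \<and> i \<le> j + 1 \<and> j \<le> i + 1}"
    and dual_tridiagonal: "i \<le> d \<Longrightarrow> v \<in> Vs i \<Longrightarrow>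
      A v \<in> subspace_sum scale Vs {j. j \<le> d \<and> i \<le> j + 1 \<and> j \<le> i + 1}"
    and eigenspace_nonzero: "i \<le> d \<Longrightarrow> V i \<noteq> {0}"
    and dual_eigenspace_nonzero: "i \<le> d \<Longrightarrow> Vs i \<noteq> {0}"
    and irreducible: "subspace S \<Longrightarrow> A ` S \<subseteq> S \<Longrightarrow> As ` S \<subseteq> S \<Longrightarrow> S = {0} \<or> S = UNIV"
begin

text \<open>
  The index of the dual flag is shifted: \<open>W i\<close> is the sum of the first \<open>i\<close> dual eigenspaces, which
  avoids an index \<open>-1\<close> and makes \<open>W i\<close> and \<open>C i\<close> complementary.
\<close>

definition "C i = subspace_sum scale V {i..d}"
definition "W i = subspace_sum scale Vs {..<i}"

lemma subspace_C: "subspace (C i)" and subspace_W: "subspace (W i)"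
  by (simp_all add: C_def W_def subspace_subspace_sum)

lemma C_antimono: "i \<le> j \<Longrightarrow> C j \<subseteq> C i" and W_mono: "i \<le> j \<Longrightarrow> W i \<subseteq> W j"
  unfolding C_def W_def by (auto intro!: subspace_sum_mono simp del: subset_iff)

lemma C_0: "C 0 = UNIV" and W_0: "W 0 = {0}"
  and C_Suc_d: "C (Suc d) = {0}" and W_Suc_d: "W (Suc d) = UNIV"
proof -
  show "C 0 = UNIV" by (simp add: C_def E.decomposition)
  show "W 0 = {0}" by (simp add: W_def subspace_sum_empty)
  show "C (Suc d) = {0}" by (simp add: C_def subspace_sum_empty)
  have "{..<Suc d} = {0..d}" by auto
  then show "W (Suc d) = UNIV" by (simp add: W_def Es.decomposition)
qed

lemma C_shift: "i \<le> d \<Longrightarrow> v \<in> C i \<Longrightarrow> A v - scale (\<theta> i) v \<in> C (Suc i)"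
proof -
  assume i: "i \<le> d" "v \<in> C i"
  have "{i..d} - {i} = {Suc i..d}" using i by auto
  then show ?thesis using E.eigen_shift[of "{i..d}" i v] i by (simp add: C_def)
qed

lemma W_shift: "i \<le> d \<Longrightarrow> v \<in> W (Suc i) \<Longrightarrow> As v - scale (\<theta>s i) v \<in> W i"
proof -
  assume i: "i \<le> d" "v \<in> W (Suc i)"
  have "{..<Suc i} - {i} = {..<i}" "{..<Suc i} \<subseteq> {0..d}" using i by auto
  then show ?thesis using Es.eigen_shift[of "{..<Suc i}" i v] i by (simp only: W_def)
qed

lemma A_W: "i \<le> d \<Longrightarrow> v \<in> W i \<Longrightarrow> A v \<in> W (Suc i)"
  unfolding W_def
proof (erule linear_maps_subspace_sum[OF E.lin.linear_axioms, rotated])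
  fix j u assume *: "i \<le> d" "j \<in> {..<i}" "u \<in> Vs j"
  then have "{k. k \<le> d \<and> j \<le> k + 1 \<and> k \<le> j + 1} \<subseteq> {..<Suc i}" by auto
  from subspace_sum_mono[OF this, of Vs] show "A u \<in> subspace_sum scale Vs {..<Suc i}"
    using * dual_tridiagonal[of j u] by auto
qed

lemma As_C: "v \<in> C (Suc i) \<Longrightarrow> As v \<in> C i"
  unfolding C_def
proof (erule linear_maps_subspace_sum[OF Es.lin.linear_axioms, rotated])
  fix j u assume *: "j \<in> {Suc i..d}" "u \<in> V j"
  then have "{k. k \<le> d \<and> j \<le> k + 1 \<and> k \<le> j + 1} \<subseteq> {i..d}" by auto
  from subspace_sum_mono[OF this, of V] show "As u \<in> subspace_sum scale V {i..d}"
    using * tridiagonal[of j u] by auto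
qed

lemma W_d_proper: "W d \<noteq> UNIV"
proof
  assume W: "W d = UNIV"
  have "v = 0" if "v \<in> Vs d" for v
  proof (rule Es.eigen_sums_disjoint[of "{..<d}" "{d}"])
    show "v \<in> subspace_sum scale Vs {..<d}" using W by (simp add: W_def)
    show "v \<in> subspace_sum scale Vs {d}" using that by (intro mem_subspace_sum) auto
  qed auto
  moreover have "0 \<in> Vs d" by (simp add: Es.mem_eigenspace)
  ultimately show False using dual_eigenspace_nonzero by blast
qed

text \<open>
  The sum of the spaces \<open>W i \<inter> C i\<close> is invariant under \<open>A\<close> and \<open>As\<close> and contained in \<open>W d\<close>, so it
  vanishes by irreducibility.
\<close>

lemma W_Int_C:
  assumes "i \<le> Suc d"
  shows "W i \<inter> C i = {0}"
proof -
  \<comment> \<open>Both ends are included although their summands are zero: the index shifts in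
    either direction then stay inside \<open>I\<close>, or start from a zero vector.\<close>
  define I where "I = {0..Suc d}"
  define U where "U i = W i \<inter> C i" for i
  define S where "S = subspace_sum scale U I"
  have U_triv: "U 0 = {0}" "U (Suc d) = {0}"
    using subspace_0[OF subspace_C] subspace_0[OF subspace_W] by (auto simp: U_def W_0 C_Suc_d)
  have zero: "0 \<in> S" unfolding S_def by (rule subspace_0[OF subspace_subspace_sum])
  have "A ` S \<subseteq> S" unfolding S_def
  proof (rule subspace_sum_invariant[OF E.lin.linear_axioms])
    fix i v assume i: "i \<in> I" "v \<in> U i"
    show "\<exists>c. A v - scale c v \<in> subspace_sum scale U I"
    proof (cases "i \<le> d")
      case True
      have "A v - scale (\<theta> i) v \<in> W (Suc i)"
        using i True A_W[of i v] W_mono[of i "Suc i"] subspace_W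
        by (auto simp: U_def intro: subspace_diff subspace_scale)
      then have "A v - scale (\<theta> i) v \<in> U (Suc i)"
        using i True C_shift[of i v] by (auto simp: U_def)
      then show ?thesis using i True mem_subspace_sum[of "Suc i" I _ U] by (auto simp: I_def)
    next
      case False
      then have "v = 0" using i U_triv by (auto simp: I_def le_Suc_eq)
      then show ?thesis using zero by (auto simp: S_def)
    qed
  qed
  moreover have "As ` S \<subseteq> S" unfolding S_def
  proof (rule subspace_sum_invariant[OF Es.lin.linear_axioms])
    fix i v assume i: "i \<in> I" "v \<in> U i"
    show "\<exists>c. As v - scale c v \<in> subspace_sum scale U I"
    proof (cases i)
      case (Suc j)
      have "As v - scale (\<theta>s j) v \<in> C j"
        using i Suc As_C[of v j] C_antimono[of j "Suc j"] subspace_C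
        by (auto simp: U_def intro: subspace_diff subspace_scale)
      then have "As v - scale (\<theta>s j) v \<in> U j"
        using i Suc W_shift[of j v] by (auto simp: U_def I_def)
      then show ?thesis using i Suc mem_subspace_sum[of j I _ U] by (auto simp: I_def)
    next
      case 0
      then have "v = 0" using i U_triv by (auto simp: I_def)
      then show ?thesis using zero by (auto simp: S_def)
    qed
  qed
  moreover have "S \<subseteq> W d"
  proof -
    have "U i \<subseteq> W d" if "i \<in> I" for i
    proof (cases "i = Suc d")
      case True
      then show ?thesis using U_triv subspace_0[OF subspace_W] by auto
    next
      case False
      then show ?thesis using that W_mono[of i d] by (auto simp: U_def I_def)
    qed
    then show ?thesis unfolding S_def subspace_sum_def by (intro span_minimal subspace_W) auto
  qed
  ultimately have "S = {0}"
    using irreducible[of S] W_d_proper subspace_subspace_sum[of U I] unfolding S_def by auto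
  moreover have "W i \<inter> C i \<subseteq> S"
    using assms mem_subspace_sum[of i I _ U] by (auto simp: S_def I_def U_def)
  ultimately show ?thesis using subspace_0[OF subspace_C] subspace_0[OF subspace_W] by auto
qed

text \<open>This is \<open>split_U\<close>; the shifted index of \<open>W\<close> accounts for the
  \<open>Suc\<close>.\<close>

definition "U i = W (Suc i) \<inter> C i"

lemma subspace_U: "subspace (U i)"
  unfolding U_def by (intro subspace_inter subspace_W subspace_C)

lemma U_shift: "i < d \<Longrightarrow> v \<in> U i \<Longrightarrow> A v - scale (\<theta> i) v \<in> U (Suc i)"
proof -
  assume i: "i < d" "v \<in> U i"
  have "A v - scale (\<theta> i) v \<in> W (Suc (Suc i))"
    using i A_W[of "Suc i" v] W_mono[of "Suc i" "Suc (Suc i)"] subspace_W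
    by (auto simp: U_def intro: subspace_diff subspace_scale)
  then show ?thesis using C_shift[of i v] i by (auto simp: U_def)
qed

lemma U_shift_top: "v \<in> U d \<Longrightarrow> A v = scale (\<theta> d) v"
  using C_shift[of d v] by (auto simp: U_def C_Suc_d)

lemma U_dual_shift: "i < d \<Longrightarrow> v \<in> U (Suc i) \<Longrightarrow> As v - scale (\<theta>s (Suc i)) v \<in> U i"
proof -
  assume i: "i < d" "v \<in> U (Suc i)"
  have "As v - scale (\<theta>s (Suc i)) v \<in> C i"
    using i As_C[of v i] C_antimono[of i "Suc i"] subspace_C
    by (auto simp: U_def intro: subspace_diff subspace_scale)
  then show ?thesis using W_shift[of "Suc i" v] i by (auto simp: U_def)
qed

text \<open>By the shift lemmas the sum is invariant under \<open>A\<close> and \<open>As\<close>.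
  It contains \<open>U d\<close>, hence the nonzero space \<open>V d\<close>, and irreducibility
  applies.\<close>

lemma sum_U: "subspace_sum scale U {0..d} = UNIV"
proof -
  define S where "S = subspace_sum scale U {0..d}"
  have zero: "0 \<in> S" unfolding S_def by (rule subspace_0[OF subspace_subspace_sum])
  have "A ` S \<subseteq> S" unfolding S_def
  proof (rule subspace_sum_invariant[OF E.lin.linear_axioms])
    fix i v assume i: "i \<in> {0..d}" "v \<in> U i"
    show "\<exists>c. A v - scale c v \<in> subspace_sum scale U {0..d}"
    proof (cases "i = d")
      case True
      then show ?thesis using i U_shift_top[of v] zero by (intro exI[of _ "\<theta> d"]) (auto simp: S_def)
    next
      case False
      then show ?thesis using i U_shift[of i v] mem_subspace_sum[of "Suc i" "{0..d}" _ U] by auto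
    qed
  qed
  moreover have "As ` S \<subseteq> S" unfolding S_def
  proof (rule subspace_sum_invariant[OF Es.lin.linear_axioms])
    fix i v assume i: "i \<in> {0..d}" "v \<in> U i"
    show "\<exists>c. As v - scale c v \<in> subspace_sum scale U {0..d}"
    proof (cases i)
      case 0
      then show ?thesis using i W_shift[of 0 v] zero
        by (intro exI[of _ "\<theta>s 0"]) (auto simp: S_def U_def W_0)
    next
      case (Suc j)
      then show ?thesis using i U_dual_shift[of j v] mem_subspace_sum[of j "{0..d}" _ U] by auto
    qed
  qed
  moreover have "V d \<subseteq> S"
    using mem_subspace_sum[of d "{0..d}" _ U] mem_subspace_sum[of d "{d}" _ V]
    by (auto simp: S_def U_def W_Suc_d C_def)
  moreover have "0 \<in> V d" by (simp add: E.mem_eigenspace)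
  moreover have "subspace S" unfolding S_def by (rule subspace_subspace_sum)
  ultimately have "S = UNIV"
    using irreducible[of S] eigenspace_nonzero[of d] by auto
  then show ?thesis by (simp add: S_def)
qed

lemma sum_U_subset_W: "subspace_sum scale U {..<i} \<subseteq> W i"
  unfolding subspace_sum_def
proof (intro span_minimal subspace_W UN_least)
  fix j assume "j \<in> {..<i}"
  then show "U j \<subseteq> W i" using W_mono[of "Suc j" i] by (auto simp: U_def)
qed

lemma sum_U_subset_C: "subspace_sum scale U {i..d} \<subseteq> C i"
  unfolding subspace_sum_def
proof (intro span_minimal subspace_C UN_least)
  fix j assume "j \<in> {i..d}"
  then show "U j \<subseteq> C i" using C_antimono[of i j] by (auto simp: U_def)
qed

lemma split_sum:
  assumes "i \<le> Suc d"
  obtains x y where "x \<in> subspace_sum scale U {..<i}" "y \<in> subspace_sum scale U {i..d}" "v = x + y"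
proof -
  have "{0..d} = {..<i} \<union> {i..d}" using assms by auto
  then have "{x + y |x y. x \<in> subspace_sum scale U {..<i} \<and> y \<in> subspace_sum scale U {i..d}} = UNIV"
    using sum_U subspace_sum_Un[of U "{..<i}" "{i..d}"] by simp
  then have "v \<in> {x + y |x y. x \<in> subspace_sum scale U {..<i} \<and> y \<in> subspace_sum scale U {i..d}}"
    by simp
  then show ?thesis using that by auto
qed

lemma W_plus_C:
  assumes "i \<le> Suc d"
  obtains x y where "x \<in> W i" "y \<in> C i" "v = x + y"
proof -
  obtain x y where "x \<in> subspace_sum scale U {..<i}" "y \<in> subspace_sum scale U {i..d}" "v = x + y"
    using split_sum[OF assms] .
  then show ?thesis using that[of x y] sum_U_subset_W[of i] sum_U_subset_C[of i] by auto
qed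

text \<open>Split a vector of \<open>W i\<close> along the \<open>U j\<close>. The part with indices
  from \<open>i\<close> on lies in \<open>C i\<close> and, as a difference, also in
  \<open>W i\<close>, so it is zero.\<close>

lemma W_eq_sum_U:
  assumes "i \<le> Suc d" shows "W i = subspace_sum scale U {..<i}"
proof
  show "W i \<subseteq> subspace_sum scale U {..<i}"
  proof
    fix v assume v: "v \<in> W i"
    obtain x y where xy: "x \<in> subspace_sum scale U {..<i}" "y \<in> subspace_sum scale U {i..d}" "v = x + y"
      using split_sum[OF assms] .
    have "v - x \<in> W i" using v xy(1) sum_U_subset_W[of i] by (intro subspace_diff subspace_W) auto
    then have "y \<in> W i" using xy(3) by simp
    then have "y = 0" using W_Int_C[OF assms] xy sum_U_subset_C[of i] by blast
    then show "v \<in> subspace_sum scale U {..<i}" using xy by simp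
  qed
qed (rule sum_U_subset_W)

lemma W_Suc_cases:
  assumes "i \<le> d" "v \<in> W (Suc i)"
  obtains x u where "x \<in> W i" "u \<in> U i" "v = x + u"
proof -
  have "{..<Suc i} = {..<i} \<union> {i}" by auto
  then have "W (Suc i) = {x + y |x y. x \<in> W i \<and> y \<in> subspace_sum scale U {i}}"
    using assms W_eq_sum_U[of i] W_eq_sum_U[of "Suc i"] subspace_sum_Un[of U "{..<i}" "{i}"] by simp
  moreover have "subspace_sum scale U {i} = U i"
    using subspace_U by (simp add: subspace_sum_def span_eq_iff)
  ultimately show ?thesis using assms that by auto
qed

section \<open>Dimensions of the flags and of the split components\<close>

lemma dim_W_C:
  assumes "i \<le> Suc d" shows "dim (W i) + dim (C i) = dimension"
proof -
  have "{x + y |x y. x \<in> W i \<and> y \<in> C i} = UNIV"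
  proof (rule UNIV_eq_I[symmetric])
    fix v
    obtain x y where "x \<in> W i" "y \<in> C i" "v = x + y" using W_plus_C[OF assms] .
    then show "v \<in> {x + y |x y. x \<in> W i \<and> y \<in> C i}" by auto
  qed
  then show ?thesis
    using dim_sums_Int[OF subspace_W subspace_C, of i i] W_Int_C[OF assms] by (simp add: dimension_def)
qed

text \<open>\<open>W (Suc i)\<close> and \<open>C i\<close> together span the space and meet in
  \<open>U i\<close>, whereas \<open>W i\<close> is a complement of \<open>C i\<close>.\<close>

lemma dim_U:
  assumes "i \<le> d" shows "dim (U i) + dim (W i) = dim (W (Suc i))"
proof -
  have "{x + y |x y. x \<in> W (Suc i) \<and> y \<in> C i} = UNIV"
  proof (rule UNIV_eq_I[symmetric])
    fix v
    obtain x y where "x \<in> W i" "y \<in> C i" "v = x + y" using W_plus_C[of i] assms le_SucI by metis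
    then show "v \<in> {x + y |x y. x \<in> W (Suc i) \<and> y \<in> C i}" using W_mono[of i "Suc i"] by auto
  qed
  then have "dim (W (Suc i)) + dim (C i) = dimension + dim (U i)"
    using dim_sums_Int[OF subspace_W subspace_C, of "Suc i" i] by (simp add: dimension_def U_def)
  then show ?thesis using dim_W_C[of i] assms by simp
qed

section \<open>Reversing the order of the eigenspaces\<close>

lemma C_reversed: "subspace_sum scale (\<lambda>j. V (d - j)) {i..d} = subspace_sum scale V {..<Suc d - i}"
proof -
  have "(\<Union>j\<in>{i..d}. V (d - j)) = (\<Union>j\<in>{..<Suc d - i}. V j)"
  proof (intro equalityI UN_least)
    fix j assume "j \<in> {..<Suc d - i}"
    then have "d - j \<in> {i..d}" "d - (d - j) = j" by auto
    then show "V j \<subseteq> (\<Union>j\<in>{i..d}. V (d - j))"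
      using UN_upper[of "d - j" _ "\<lambda>j. V (d - j)"] by simp
  next
    fix j assume "j \<in> {i..d}"
    then have "d - j \<in> {..<Suc d - i}" by auto
    then show "V (d - j) \<subseteq> (\<Union>j\<in>{..<Suc d - i}. V j)" by (rule UN_upper)
  qed
  then show ?thesis by (simp add: subspace_sum_def)
qed

text \<open>Tridiagonality is symmetric under reversing the order. All results on \<open>U\<close>
  thus carry over to \<open>U_down\<close>, with the same dual flag \<open>W\<close>.\<close>

lemma td_split_reversed: "td_split scale Basis A As d (\<lambda>i. V (d - i)) Vs (\<lambda>i. \<theta> (d - i)) \<theta>s"
proof (intro td_split.intro td_split_axioms.intro)
  show "finite_dimensional_vector_space scale Basis" by unfold_locales
  show "eigenspace_decomposition scale As d Vs \<theta>s" by unfold_locales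
  have UNIV: "subspace_sum scale (\<lambda>i. V (d - i)) {0..d} = UNIV"
    using C_reversed[of 0] E.decomposition by (simp add: lessThan_Suc_atMost atLeast0AtMost)
  have "inj_on (\<lambda>i. \<theta> (d - i)) {0..d}"
    using E.inj_eigenvalues by (fastforce simp: inj_on_def)
  then show "eigenspace_decomposition scale A d (\<lambda>i. V (d - i)) (\<lambda>i. \<theta> (d - i))"
    using E.eigenspaces_eq UNIV by unfold_locales auto
  fix i v assume i: "i \<le> d" "v \<in> V (d - i)"
  show "As v \<in> subspace_sum scale (\<lambda>j. V (d - j)) {j. j \<le> d \<and> i \<le> j + 1 \<and> j \<le> i + 1}"
  proof -
    have "(\<Union>j\<in>{j. j \<le> d \<and> d - i \<le> j + 1 \<and> j \<le> d - i + 1}. V j)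
        \<subseteq> (\<Union>j\<in>{j. j \<le> d \<and> i \<le> j + 1 \<and> j \<le> i + 1}. V (d - j))"
    proof (rule UN_least)
      fix j assume "j \<in> {j. j \<le> d \<and> d - i \<le> j + 1 \<and> j \<le> d - i + 1}"
      then have "d - j \<in> {j. j \<le> d \<and> i \<le> j + 1 \<and> j \<le> i + 1}" "d - (d - j) = j" using i by auto
      then show "V j \<subseteq> (\<Union>j\<in>{j. j \<le> d \<and> i \<le> j + 1 \<and> j \<le> i + 1}. V (d - j))"
        using UN_upper[of "d - j" _ "\<lambda>j. V (d - j)"] by simp
    qed
    from span_mono[OF this] show ?thesis
      using tridiagonal[of "d - i" v] i(2) unfolding subspace_sum_def by (simp add: subset_iff)
  qed
qed (use dual_tridiagonal eigenspace_nonzero dual_eigenspace_nonzero irreducible in auto)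

interpretation rev: td_split scale Basis A As d "\<lambda>i. V (d - i)" Vs "\<lambda>i. \<theta> (d - i)" \<theta>s
  by (rule td_split_reversed)

text \<open>For \<open>i \<le> d\<close> this is \<open>split_U_down\<close>. The direct formula can
  be used without the reversed instance; \<open>U_down_eq\<close> links the two.\<close>

definition U_down :: "nat \<Rightarrow> 'v set" where
  "U_down i = W (Suc i) \<inter> subspace_sum scale V {..<Suc d - i}"

lemma U_down_eq: "td_split.U scale d (\<lambda>i. V (d - i)) Vs = U_down"
  by (simp add: fun_eq_iff rev.U_def U_down_def rev.C_def C_reversed)

text \<open>The sum of the first \<open>i\<close> spaces \<open>V j\<close> is a complement of
  \<open>C i\<close>, so it has the dimension of \<open>W i\<close>; in the reversed order it is a
  complement of \<open>W (Suc d - i)\<close>.\<close>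

lemma dim_W_reflect:
  assumes "i \<le> Suc d" shows "dim (W i) + dim (W (Suc d - i)) = dimension"
proof -
  let ?N = "subspace_sum scale V {..<i}"
  have "{0..d} = {..<i} \<union> {i..d}" using assms by auto
  then have "{x + y |x y. x \<in> ?N \<and> y \<in> C i} = UNIV"
    using subspace_sum_Un[of V "{..<i}" "{i..d}"] E.decomposition by (simp add: C_def)
  moreover have "?N \<inter> C i = {0}"
  proof (intro equalityI subsetI)
    fix v assume "v \<in> ?N \<inter> C i"
    moreover have "{..<i} \<subseteq> {0..d}" using assms by auto
    ultimately show "v \<in> {0}"
      using E.eigen_sums_disjoint[of "{..<i}" "{i..d}" v] by (simp add: C_def ivl_disj_int)
  qed (simp add: C_def subspace_0[OF subspace_subspace_sum])
  ultimately have "dim ?N + dim (C i) = dimension"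
    using dim_sums_Int[OF subspace_subspace_sum[of V "{..<i}"] subspace_C[of i]] by (simp add: dimension_def)
  moreover have "dim (W (Suc d - i)) + dim ?N = dimension"
    using rev.dim_W_C[of "Suc d - i"] assms by (simp add: rev.C_def C_reversed)
  ultimately show ?thesis using dim_W_C[OF assms] by simp
qed

lemma dim_U_reflect:
  assumes "i \<le> d" shows "dim (U (d - i)) = dim (U i)"
proof -
  have "dim (W i) + dim (W (Suc (d - i))) = dimension" "dim (W (Suc i)) + dim (W (d - i)) = dimension"
    using dim_W_reflect[of i] dim_W_reflect[of "Suc i"] assms by (simp_all add: Suc_diff_le)
  then show ?thesis using dim_U[OF assms] dim_U[of "d - i"] by linarith
qed

text \<open>The product of the \<open>n\<close> maps \<open>A - \<theta> j\<close> with
  \<open>k \<le> j < k + n\<close>, which raises \<open>U k\<close> to \<open>U (k + n)\<close> as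
  long as \<open>k + n \<le> d\<close>.\<close>

primrec tau :: "nat \<Rightarrow> nat \<Rightarrow> 'v \<Rightarrow> 'v" where
  "tau k 0 v = v"
| "tau k (Suc n) v = A (tau k n v) - scale (\<theta> (k + n)) (tau k n v)"

lemma linear_tau: "Vector_Spaces.linear scale scale (tau k n)"
proof (induction n)
  case 0
  show ?case by unfold_locales auto
next
  case (Suc n)
  interpret tau: Vector_Spaces.linear scale scale "tau k n" by fact
  show ?case
    by unfold_locales (simp_all add: E.lin.add E.lin.scale tau.add tau.scale
        scale_right_distrib scale_right_diff_distrib scale_left_commute)
qed

lemma tau_Suc_left: "tau k (Suc n) v = tau (Suc k) n (A v - scale (\<theta> k) v)"
  by (induction n) auto

lemma tau_U: "k + n \<le> d \<Longrightarrow> v \<in> U k \<Longrightarrow> tau k n v \<in> U (k + n)"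
  by (induction n) (use U_shift in auto)

lemma tau_mem_sum:
  assumes "k + n \<le> m" "m \<le> Suc d" "tau k n v \<in> subspace_sum scale V {..<m}"
  shows "v \<in> subspace_sum scale V {..<m}"
  using assms
proof (induction n)
  case (Suc n)
  have "A (tau k n v) - scale (\<theta> (k + n)) (tau k n v) \<in> subspace_sum scale V {..<m}"
    using Suc.prems(3) by simp
  then have "tau k n v \<in> subspace_sum scale V {..<m}"
    by (rule E.mem_sum_of_shift_mem[rotated 2]) (use Suc.prems in auto)
  then show ?case by (rule Suc.IH[rotated 2]) (use Suc.prems in auto)
qed simp

text \<open>
  The kernel of the map lies in \<open>W (Suc k) \<inter> (V 0 + \<dots> + V (d - k - 1))\<close>, which is zero by
  \<open>W_Int_C\<close> for the reversed ordering of the \<open>V i\<close>; both spaces have the same dimension.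
\<close>

lemma tau_surj:
  assumes "2 * k \<le> d" shows "tau k (d - 2 * k) ` U k = U (d - k)"
proof -
  interpret tau: Vector_Spaces.linear scale scale "tau k (d - 2 * k)" by (rule linear_tau)
  interpret pair: finite_dimensional_vector_space_pair_1 scale Basis scale by unfold_locales
  have "v = 0" if v: "v \<in> U k" "tau k (d - 2 * k) v = 0" for v
  proof -
    have "v \<in> subspace_sum scale V {..<d - k}"
      by (rule tau_mem_sum[of k "d - 2 * k"])
        (use assms v(2) subspace_0[OF subspace_subspace_sum] in auto)
    then have "v \<in> W (Suc k) \<inter> rev.C (Suc k)"
      using v(1) by (simp add: U_def rev.C_def C_reversed)
    then show ?thesis using rev.W_Int_C[of "Suc k"] assms by auto
  qed
  then have "inj_on (tau k (d - 2 * k)) (U k)"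
    using tau.inj_on_iff_eq_0[OF subspace_U] by blast
  then have "dim (tau k (d - 2 * k) ` U k) = dim (U (d - k))"
    using pair.dim_image_eq[OF linear_tau, of k "d - 2 * k" "U k"] subspace_U[of k] dim_U_reflect[of k] assms
    by (simp add: span_eq_iff[THEN iffD2])
  moreover have "tau k (d - 2 * k) ` U k \<subseteq> U (d - k)"
    using tau_U[of k "d - 2 * k"] assms by (auto simp: algebra_simps)
  ultimately show ?thesis
    using subspace_U by (intro subspace_dim_equal tau.subspace_image) auto
qed

text \<open>In the lower half, \<open>tau_surj\<close> yields \<open>u'\<close> such that
  \<open>u\<close> and \<open>(A - \<theta> i) u'\<close> have the same image in
  \<open>U (d - i)\<close>. Their difference is killed by the product of the
  \<open>A - \<theta> j\<close> with \<open>i < j < d - i\<close>, which confines it to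
  \<open>U_down (Suc i)\<close>. In the upper half \<open>u\<close> itself is an image under
  \<open>A - \<theta> i\<close>, and \<open>w = 0\<close>.\<close>

lemma U_Suc_decompose:
  assumes "i < d" "u \<in> U (Suc i)"
  obtains u' w where "u' \<in> U i" "w \<in> U (Suc i) \<inter> U_down (Suc i)"
    "u = (A u' - scale (\<theta> i) u') + w"
proof (cases "2 * Suc i \<le> d")
  case True
  \<comment> \<open>These are \<open>d - 2 * i - 1\<close> factors: they lead from
    \<open>U (Suc i)\<close> to \<open>U (d - i)\<close>, and \<open>Suc n\<close> factors lead
    there from \<open>U i\<close>.\<close>
  define n where "n = d - 2 * Suc i + 1"
  interpret tau: Vector_Spaces.linear scale scale "tau (Suc i) n" by (rule linear_tau)
  have "tau (Suc i) n u \<in> U (d - i)"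
    using tau_U[of "Suc i" n u] assms True by (simp add: n_def numeral_2_eq_2 Suc_diff_Suc del: tau.simps)
  also have "U (d - i) = tau i (Suc n) ` U i"
    using tau_surj[of i] True by (simp add: n_def numeral_2_eq_2 Suc_diff_Suc)
  finally obtain u' where u': "u' \<in> U i" "tau (Suc i) n u = tau i (Suc n) u'" by auto
  define w where "w = u - (A u' - scale (\<theta> i) u')"
  have "tau (Suc i) n w = 0"
    using u' by (simp only: w_def tau.diff tau_Suc_left) simp
  then have "tau (Suc i) n w \<in> subspace_sum scale V {..<d - i}"
    using subspace_0[OF subspace_subspace_sum] by simp
  then have "w \<in> subspace_sum scale V {..<d - i}"
    by (rule tau_mem_sum[of "Suc i" n, rotated 2]) (use True in \<open>auto simp: n_def\<close>)
  moreover have "w \<in> U (Suc i)"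
    unfolding w_def by (rule subspace_diff[OF subspace_U]) (use assms u' U_shift in auto)
  ultimately have "w \<in> U (Suc i) \<inter> U_down (Suc i)"
    by (simp add: U_down_def U_def)
  then show ?thesis using u' by (intro that[of u' w]) (auto simp: w_def)
next
  case False
  define k where "k = d - Suc i"
  have k: "2 * k \<le> d" "d - k = Suc i" using False assms by (auto simp: k_def)
  then obtain v where v: "v \<in> U k" "u = tau k (d - 2 * k) v"
    using tau_surj[OF k(1)] assms unfolding k(2) by blast
  \<comment> \<open>Hence the last factor of \<open>tau k (d - 2 * k)\<close> is
    \<open>A - \<theta> i\<close>, applied to an element of \<open>U i\<close>.\<close>
  have "d - 2 * k = Suc (i - k)" "k + (i - k) = i" using False assms by (auto simp: k_def)
  then have "u = A (tau k (i - k) v) - scale (\<theta> i) (tau k (i - k) v) + 0" "tau k (i - k) v \<in> U i"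
    using v tau_U[of k "i - k" v] assms by auto
  moreover have "0 \<in> U (Suc i) \<inter> U_down (Suc i)"
    using subspace_0[OF subspace_U] subspace_0[OF rev.subspace_U] by (simp add: U_down_eq)
  ultimately show ?thesis using that by blast
qed

section \<open>Maps that are diagonal on the split decomposition\<close>

lemma eq_0_on_U:
  assumes "Vector_Spaces.linear scale scale f" "\<And>i v. i \<le> d \<Longrightarrow> v \<in> U i \<Longrightarrow> f v = 0"
  shows "f v = 0"
proof -
  interpret f: Vector_Spaces.linear scale scale f by fact
  have "v \<in> span (\<Union>i\<in>{0..d}. U i)" using sum_U by (simp add: subspace_sum_def)
  then show ?thesis by (rule f.eq_0_on_span[rotated]) (use assms(2) in auto)
qed

text \<open>On \<open>U i\<close>, the raised part \<open>u\<close> of \<open>A v\<close> is zero or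
  an eigenvector of \<open>f\<close> for \<open>p * k i\<close>, so it cancels. What remains is
  \<open>(1 - p) * \<theta> i * k i\<close>, which the last hypothesis makes quadratic in
  \<open>f\<close>. This serves for \<open>K\<close> and, in the reversed order, for
  \<open>B\<close>.\<close>

lemma diagonal_on_U_commutation:
  assumes lin: "Vector_Spaces.linear scale scale f"
    and f: "\<And>i v. i \<le> d \<Longrightarrow> v \<in> U i \<Longrightarrow> f v = scale (k i) v"
    and k: "\<And>i. i < d \<Longrightarrow> k (Suc i) = p * k i"
    and \<theta>: "\<And>i. i \<le> d \<Longrightarrow> \<theta> i * k i = e * k i * k i + e'"
  shows "f (A v) = scale p (A (f v)) + scale (1 - p) (scale e (f (f v)) + scale e' v)"
proof -
  interpret f: Vector_Spaces.linear scale scale f by fact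
  let ?g = "\<lambda>v. f (A v) - scale p (A (f v)) - scale (1 - p) (scale e (f (f v)) + scale e' v)"
  have lin: "Vector_Spaces.linear scale scale ?g"
    by unfold_locales
      (simp_all add: f.add f.scale E.lin.add E.lin.scale algebra_simps)
  have "?g v = 0"
  proof (rule eq_0_on_U[OF lin])
    fix i v assume i: "i \<le> d" "v \<in> U i"
    define u where "u = A v - scale (\<theta> i) v"
    have A: "A v = scale (\<theta> i) v + u" by (simp add: u_def)
    have fu: "f u = scale (p * k i) u"
    proof (cases "i = d")
      case True
      then show ?thesis using i U_shift_top[of v] by (simp add: u_def)
    next
      case False
      then show ?thesis using i U_shift[of i v] f[of "Suc i" u] k[of i] by (simp add: u_def)
    qed
    have "?g v = scale ((1 - p) * (\<theta> i * k i - (e * k i * k i + e'))) v"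
      using i by (simp add: A fu f.add f.scale E.lin.scale f[of i v] algebra_simps)
    then show "?g v = 0" using \<theta>[OF i(1)] by simp
  qed
  then show ?thesis by (simp add: algebra_simps)
qed

lemma diagonal_on_U_W:
  assumes lin: "Vector_Spaces.linear scale scale f"
    and f: "\<And>i v. i \<le> d \<Longrightarrow> v \<in> U i \<Longrightarrow> f v = scale (k i) v"
    and "i \<le> Suc d" "v \<in> W i"
  shows "f v \<in> W i"
proof -
  have "f v \<in> subspace_sum scale U {..<i}"
  proof (rule linear_maps_subspace_sum[OF lin])
    show "v \<in> subspace_sum scale U {..<i}" using assms(3,4) W_eq_sum_U by simp
    fix j u assume "j \<in> {..<i}" "u \<in> U j"
    then show "f u \<in> subspace_sum scale U {..<i}"
      using f[of j u] assms(3) mem_subspace_sum[of j "{..<i}" u U]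
      by (auto intro!: subspace_scale subspace_subspace_sum)
  qed
  then show ?thesis using sum_U_subset_W by auto
qed

lemma diagonal_on_U_W_Suc:
  assumes lin: "Vector_Spaces.linear scale scale f"
    and f: "\<And>i v. i \<le> d \<Longrightarrow> v \<in> U i \<Longrightarrow> f v = scale (k i) v"
    and "i \<le> d" "v \<in> W (Suc i)"
  shows "f v - scale (k i) v \<in> W i"
proof -
  interpret f: Vector_Spaces.linear scale scale f by fact
  obtain x u where xu: "x \<in> W i" "u \<in> U i" "v = x + u"
    using W_Suc_cases[OF assms(3,4)] .
  then have "f v - scale (k i) v = f x - scale (k i) x"
    using f[of i u] assms(3) by (simp add: f.add scale_right_distrib)
  then show ?thesis
    using xu(1) assms(3) diagonal_on_U_W[OF lin f _ xu(1)]
    by (auto intro!: subspace_diff subspace_scale subspace_W)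
qed

end

section \<open>The \<open>q\<close>-Racah relations\<close>

text \<open>
  For \<open>p = q\<^sup>-\<^sup>2\<close> and \<open>w = y\<^sup>-\<^sup>1\<close>, vanishing of \<open>defect p w z w\<close> and of \<open>defect p w w x\<close> expresses the
  relations of \<open>y\<close> with \<open>z\<close> and with \<open>x\<close>, multiplied by \<open>w\<close> on both sides.
\<close>

definition (in vector_space) defect :: "'a \<Rightarrow> ('b \<Rightarrow> 'b) \<Rightarrow> ('b \<Rightarrow> 'b) \<Rightarrow> ('b \<Rightarrow> 'b) \<Rightarrow> 'b \<Rightarrow> 'b" where
  "defect p w f g v = f (g v) - scale p (g (f v)) - scale (1 - p) (w (w v))"

text \<open>Expanding the relation of \<open>z'\<close> and \<open>x'\<close> and subtracting that
  of \<open>z\<close> and \<open>x\<close> leaves \<open>c - 1\<close> times the claim, because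
  \<open>c * c' = 1\<close>. In the application \<open>c\<close> is \<open>a\<^sup>2\<close>, and
  \<open>z'\<close> and \<open>x'\<close> are the operators of Z and X.\<close>

lemma (in vector_space) defects_proportional:
  assumes lin: "Vector_Spaces.linear scale scale x" "Vector_Spaces.linear scale scale w"
      "Vector_Spaces.linear scale scale z"
    and zx: "\<And>v. z (x v) = scale p (x (z v)) + scale (1 - p) v"
    and zx': "\<And>v. z' (x' v) = scale p (x' (z' v)) + scale (1 - p) v"
    and z': "\<And>v. z' v = scale c (z v) + scale (1 - c) (w v)"
    and x': "\<And>v. x' v = scale c' (x v) + scale (1 - c') (w v)"
    and c: "c * c' = 1" "c \<noteq> 1"
  shows "defect p w z w v = scale c' (defect p w w x v)"
proof -
  interpret x: Vector_Spaces.linear scale scale x by fact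
  interpret w: Vector_Spaces.linear scale scale w by fact
  interpret z: Vector_Spaces.linear scale scale z by fact
  have cc: "c * (c' * t) = t" for t using c(1) by (simp flip: mult.assoc)
  have "scale (c - 1) (defect p w z w v - scale c' (defect p w w x v))
      = (z' (x' v) - scale p (x' (z' v))) - (z (x v) - scale p (x (z v)))"
    unfolding z' x' defect_def
    by (simp add: x.add x.scale w.add w.scale z.add z.scale x.diff w.diff z.diff algebra_simps c(1) cc)
  also have "\<dots> = 0" by (simp add: zx zx')
  finally show ?thesis using c by simp
qed

text \<open>Both sides arise from reducing \<open>z w x\<close>, starting with \<open>z w\<close> or with \<open>w x\<close>.\<close>

lemma (in vector_space) defect_overlap:
  assumes lin: "Vector_Spaces.linear scale scale x" "Vector_Spaces.linear scale scale w"
      "Vector_Spaces.linear scale scale z"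
    and zx: "\<And>v. z (x v) = scale p (x (z v)) + scale (1 - p) v"
  defines "G \<equiv> defect p w z w" and "H \<equiv> defect p w w x"
  shows "scale (p\<^sup>2) (H (z v)) + scale (1 - p) (scale p (H (w v)) + w (H v)) + G (x v) =
    scale (p\<^sup>2) (x (G v)) + scale (1 - p) (G (w v) + scale p (w (G v))) + z (H v)"
proof -
  interpret x: Vector_Spaces.linear scale scale x by fact
  interpret w: Vector_Spaces.linear scale scale w by fact
  interpret z: Vector_Spaces.linear scale scale z by fact
  show ?thesis
    unfolding G_def H_def defect_def
    by (simp add: x.add x.scale w.add w.scale z.add z.scale x.diff w.diff z.diff zx power2_eq_square
      algebra_simps)
qed

locale q_racah_split = td_split scale Basis A As d V Vs \<theta> \<theta>s
  for scale :: "'f::field \<Rightarrow> 'v::ab_group_add \<Rightarrow> 'v" and Basis A As d V Vs \<theta> \<theta>s +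
  fixes q a :: 'f and K B :: "'v \<Rightarrow> 'v"
  assumes q_nonzero: "q \<noteq> 0" and a_nonzero: "a \<noteq> 0" and a_square: "a\<^sup>2 \<noteq> 1"
    and q_racah: "i \<le> d \<Longrightarrow> \<theta> i = a * q powi (int d - 2 * int i) + inverse a * q powi (2 * int i - int d)"
    and linear_K: "Vector_Spaces.linear scale scale K"
    and K_U: "i \<le> d \<Longrightarrow> v \<in> U i \<Longrightarrow> K v = scale (q powi (int d - 2 * int i)) v"
    and linear_B: "Vector_Spaces.linear scale scale B"
    and B_U_down: "i \<le> d \<Longrightarrow> v \<in> U_down i \<Longrightarrow> B v = scale (q powi (int d - 2 * int i)) v"
begin

interpretation rev: td_split scale Basis A As d "\<lambda>i. V (d - i)" Vs "\<lambda>i. \<theta> (d - i)" \<theta>s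
  by (rule td_split_reversed)

interpretation K: Vector_Spaces.linear scale scale K by (rule linear_K)
interpretation B: Vector_Spaces.linear scale scale B by (rule linear_B)

section \<open>Relations of \<open>K\<close> and \<open>B\<close> with \<open>A\<close>\<close>

definition k :: "nat \<Rightarrow> 'f" where "k i = q powi (int d - 2 * int i)"
definition p :: 'f where "p = inverse (q\<^sup>2)"

lemma k_nonzero: "k i \<noteq> 0"
  by (simp add: k_def q_nonzero)

lemma k_Suc: "k (Suc i) = p * k i"
proof -
  have "int d - 2 * int (Suc i) = - 2 + (int d - 2 * int i)" by simp
  then have "k (Suc i) = q powi (- 2) * k i"
    using q_nonzero unfolding k_def by (simp only: power_int_add[OF disjI1[OF q_nonzero]])
  then show ?thesis by (simp add: p_def power_int_minus)
qed

lemma \<theta>_eq: "i \<le> d \<Longrightarrow> \<theta> i = a * k i + inverse a * inverse (k i)"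
proof -
  have "2 * int i - int d = - (int d - 2 * int i)" by simp
  then show "i \<le> d \<Longrightarrow> ?thesis" using q_racah[of i] by (simp only: k_def power_int_minus)
qed

lemma k_reflect: "i \<le> d \<Longrightarrow> k (d - i) = inverse (k i)"
proof -
  assume "i \<le> d"
  then have "int d - 2 * int (d - i) = - (int d - 2 * int i)" by simp
  then show ?thesis by (simp only: k_def power_int_minus)
qed

lemma B_rev: "i \<le> d \<Longrightarrow> v \<in> rev.U i \<Longrightarrow> B v = scale (k i) v"
  using B_U_down by (simp add: U_down_eq k_def)

lemma K_k: "i \<le> d \<Longrightarrow> v \<in> U i \<Longrightarrow> K v = scale (k i) v"
  using K_U by (simp add: k_def)

lemma K_A: "K (A v) = scale p (A (K v)) + scale (1 - p) (scale a (K (K v)) + scale (inverse a) v)"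
  by (rule diagonal_on_U_commutation[where k = k, OF linear_K K_k k_Suc])
    (auto simp: \<theta>_eq k_nonzero algebra_simps)

lemma B_A: "B (A v) = scale p (A (B v)) + scale (1 - p) (scale (inverse a) (B (B v)) + scale a v)"
  by (rule rev.diagonal_on_U_commutation[where k = k, OF linear_B B_rev k_Suc])
    (auto simp: \<theta>_eq k_nonzero k_reflect algebra_simps)

text \<open>\<open>w\<close> and \<open>x\<close> are the only candidates for the actions of the
  inverse of y and of x: \<open>act_determined\<close> derives these formulas from the actions of z,
  Z and A.\<close>

definition w :: "'v \<Rightarrow> 'v" where
  "w v = scale (inverse (a - inverse a)) (scale a (K v) - scale (inverse a) (B v))"

definition x :: "'v \<Rightarrow> 'v" where
  "x v = scale a (A v) - scale (a\<^sup>2) (K v)"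

lemma a_diff_nonzero: "a - inverse a \<noteq> 0"
proof
  assume "a - inverse a = 0"
  then have "a * a = a * inverse a" by simp
  then show False using a_nonzero a_square by (simp add: power2_eq_square)
qed

lemma linear_w: "Vector_Spaces.linear scale scale w"
  by unfold_locales (simp_all add: w_def K.add K.scale B.add B.scale algebra_simps)

lemma linear_x: "Vector_Spaces.linear scale scale x"
  by unfold_locales (simp_all add: x_def K.add K.scale E.lin.add E.lin.scale algebra_simps)

interpretation w: Vector_Spaces.linear scale scale w by (rule linear_w)
interpretation x: Vector_Spaces.linear scale scale x by (rule linear_x)

text \<open>Subtracting \<open>a\<^sup>2\<close> times \<open>K\<close> in \<open>x\<close> cancels
  exactly the term of \<open>K_A\<close> that is quadratic in \<open>K\<close>.\<close>

lemma K_x: "K (x v) = scale p (x (K v)) + scale (1 - p) v"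
  using a_nonzero
  by (simp add: x_def K.diff K.scale K_A algebra_simps power2_eq_square)

lemma B_x':
  defines "x' \<equiv> \<lambda>v. scale (inverse a) (A v) - scale (inverse (a\<^sup>2)) (B v)"
  shows "B (x' v) = scale p (x' (B v)) + scale (1 - p) v"
  using a_nonzero
  by (simp add: x'_def B.diff B.scale B_A algebra_simps power2_eq_square)

text \<open>This and \<open>x'_eq\<close> are the defining formulas of Z and X for the operators, in
  the form that \<open>defects_proportional\<close> requires.\<close>

lemma B_eq: "B v = scale (a\<^sup>2) (K v) + scale (1 - a\<^sup>2) (w v)"
proof -
  have "(1 - a\<^sup>2) * inverse (a - inverse a) = - a"
    using a_nonzero a_diff_nonzero by (simp add: field_simps power2_eq_square)
  then have "scale (1 - a\<^sup>2) (w v) = scale (- a) (scale a (K v) - scale (inverse a) (B v))"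
    by (simp only: w_def scale_scale)
  then show ?thesis using a_nonzero by (simp add: algebra_simps power2_eq_square)
qed

lemma x'_eq: "scale (inverse a) (A v) - scale (inverse (a\<^sup>2)) (B v) =
    scale (inverse (a\<^sup>2)) (x v) + scale (1 - inverse (a\<^sup>2)) (w v)"
  using a_nonzero by (simp add: x_def B_eq algebra_simps power2_eq_square)

lemma defect_K_eq: "defect p w K w v = scale (inverse (a\<^sup>2)) (defect p w w x v)"
  by (rule defects_proportional[OF linear_x linear_w linear_K K_x B_x' B_eq x'_eq])
    (use a_nonzero a_square in auto)

lemma linear_defect: "Vector_Spaces.linear scale scale (defect p w K w)"
  by unfold_locales (simp_all add: defect_def w.add w.scale K.add K.scale algebra_simps)

interpretation G: Vector_Spaces.linear scale scale "defect p w K w" by (rule linear_defect)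

section \<open>Triangular action on the dual flag\<close>

lemma K_W: "i \<le> Suc d \<Longrightarrow> v \<in> W i \<Longrightarrow> K v \<in> W i"
  by (rule diagonal_on_U_W[OF linear_K K_k])

lemma w_W: "i \<le> Suc d \<Longrightarrow> v \<in> W i \<Longrightarrow> w v \<in> W i"
  unfolding w_def
  by (intro subspace_scale subspace_diff subspace_W K_W rev.diagonal_on_U_W[OF linear_B B_rev])

text \<open>On the quotient of \<open>W (Suc i)\<close> by \<open>W i\<close> both \<open>K\<close>
  and \<open>B\<close> are the scalar \<open>k i\<close>, and their coefficients in \<open>w\<close>
  add up to one.\<close>

lemma w_W_Suc:
  assumes "i \<le> d" "v \<in> W (Suc i)"
  shows "w v - scale (k i) v \<in> W i"
proof -
  have "scale (inverse (a - inverse a)) (scale a (K v - scale (k i) v)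
      - scale (inverse a) (B v - scale (k i) v)) \<in> W i"
    using assms by (intro subspace_scale subspace_diff subspace_W
        diagonal_on_U_W_Suc[OF linear_K K_k] rev.diagonal_on_U_W_Suc[OF linear_B B_rev])
  moreover have "scale (inverse (a - inverse a)) (scale a (K v - scale (k i) v)
      - scale (inverse a) (B v - scale (k i) v)) =
      w v - scale (inverse (a - inverse a) * (a - inverse a)) (scale (k i) v)"
    by (simp only: w_def scale_scale[symmetric] scale_right_diff_distrib scale_left_diff_distrib) simp
  ultimately show ?thesis using a_diff_nonzero by simp
qed

text \<open>Here \<open>K\<close>, \<open>B\<close> and hence \<open>w\<close> all act as
  \<open>k i\<close>, and \<open>k i * k i\<close> gets the coefficient
  \<open>1 - p - (1 - p)\<close>.\<close>

lemma defect_vanishes_on_eigenvectors: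
  assumes "i \<le> d" "v \<in> U i" "v \<in> U_down i"
  shows "defect p w K w v = 0"
proof -
  have K: "K v = scale (k i) v" using assms K_k by simp
  have "B v = scale (k i) v" using assms B_U_down by (simp add: k_def)
  then have "w v = scale (inverse (a - inverse a) * (a - inverse a)) (scale (k i) v)"
    by (simp only: w_def K scale_scale[symmetric] scale_left_diff_distrib)
  then have "w v = scale (k i) v" using a_diff_nonzero by simp
  then show ?thesis by (simp add: defect_def K K.scale w.scale algebra_simps)
qed

lemma defect_vanishes: "defect p w K w v = 0"
proof -
  have "defect p w K w v = 0" if "i \<le> Suc d" "v \<in> W i" for i v
    using that
  proof (induction i arbitrary: v)
    case 0
    then show ?case by (simp add: W_0)
  next
    case (Suc i)
    have i: "i \<le> d" "i \<le> Suc d" using Suc.prems by auto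
    have IH: "defect p w K w u = 0" "defect p w w x u = 0" if "u \<in> W i" for u
    proof -
      show 0: "defect p w K w u = 0" using Suc.IH that i by simp
      then show "defect p w w x u = 0" using defect_K_eq[of u] a_nonzero by simp
    qed
    obtain y u where yu: "y \<in> W i" "u \<in> U i" "v = y + u"
      using W_Suc_cases[OF i(1) Suc.prems(2)] .
    have "defect p w K w u = 0"
    proof (cases i)
      case 0
      \<comment> \<open>At index 0 the sums of the \<open>V j\<close> are the whole space in both
        orders, so \<open>U 0\<close> and \<open>U_down 0\<close> are both
        \<open>W 1\<close>.\<close>
      have "u \<in> U_down 0" using yu(2) rev.C_0 unfolding 0 by (simp add: U_def U_down_def rev.C_def C_reversed)
      then show ?thesis using defect_vanishes_on_eigenvectors[of 0 u] yu(2) 0 by simp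
    next
      case (Suc j)
      then have j: "j < d" using i by simp
      obtain u' t where u': "u' \<in> U j" and t: "t \<in> U i \<inter> U_down i"
        and u: "u = (A u' - scale (\<theta> j) u') + t"
        using U_Suc_decompose[OF j] yu(2) Suc by metis
      have u'W: "u' \<in> W i" using u' Suc by (simp add: U_def)
      \<comment> \<open>\<open>K u'\<close> and \<open>w u'\<close> stay in \<open>W i\<close>, so
        in \<open>defect_overlap\<close> every term except the defect at \<open>x u'\<close>
        vanishes, although \<open>x u'\<close> itself need not lie in \<open>W i\<close>.\<close>
      note vanish = IH[OF u'W] IH[OF K_W[OF i(2) u'W]] IH[OF w_W[OF i(2) u'W]]
      have "defect p w K w (x u') = 0"
        using defect_overlap[OF linear_x linear_w linear_K K_x, of u'] by (simp add: vanish)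
      moreover have "A u' = scale (inverse a) (x u') + scale a (K u')"
        using a_nonzero by (simp add: x_def scale_right_diff_distrib power2_eq_square)
      ultimately have "defect p w K w (A u') = 0"
        by (simp add: G.add G.scale vanish)
      moreover have "defect p w K w t = 0"
        using t i defect_vanishes_on_eigenvectors by blast
      ultimately show ?thesis by (simp add: u G.add G.diff G.scale vanish)
    qed
    then show ?case using IH yu by (simp add: G.add)
  qed
  from this[of "Suc d"] show ?thesis by (simp add: W_Suc_d)
qed

lemma K_w: "K (w v) = scale p (w (K v)) + scale (1 - p) (w (w v))"
  using defect_vanishes[of v] by (simp add: defect_def algebra_simps)

lemma w_x: "w (x v) = scale p (x (w v)) + scale (1 - p) (w (w v))"
proof -
  have "defect p w w x v = 0" using defect_vanishes[of v] defect_K_eq[of v] a_nonzero by simp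
  then show ?thesis by (simp add: defect_def algebra_simps)
qed

text \<open>Along the dual flag \<open>w\<close> is triangular with nonzero diagonal entries
  \<open>k i\<close>. A kernel vector therefore descends to \<open>W 0\<close>, and finite dimension
  turns injectivity into bijectivity.\<close>

lemma bij_w: "bij w"
proof -
  have "v = 0" if "i \<le> Suc d" "v \<in> W i" "w v = 0" for i v
    using that
  proof (induction i)
    case 0
    then show ?case by (simp add: W_0)
  next
    case (Suc i)
    then have "scale (- inverse (k i)) (w v - scale (k i) v) \<in> W i"
      by (intro subspace_scale subspace_W w_W_Suc) auto
    then show ?case using Suc k_nonzero by simp
  qed
  from this[of "Suc d"] have "inj w"
    by (simp add: W_Suc_d w.inj_iff_eq_0)
  then show ?thesis using linear_inj_imp_surj[OF linear_w] by (simp add: bij_def)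
qed

end

section \<open>Modules over the subalgebra \<open>uq_vee\<close>\<close>

lemma ring_of_type_algebra_simps [simp]:
  "carrier ring_of_type_algebra = UNIV"
  "x \<otimes>\<^bsub>ring_of_type_algebra\<^esub> y = x * y" "x \<oplus>\<^bsub>ring_of_type_algebra\<^esub> y = x + y"
  "\<one>\<^bsub>ring_of_type_algebra\<^esub> = 1" "\<zero>\<^bsub>ring_of_type_algebra\<^esub> = 0"
  by (simp_all add: ring_of_type_algebra_def)

lemma ring_ring_of_type_algebra: "ring (ring_of_type_algebra :: 'a::ring_1 ring)"
proof (rule ringI)
  show "abelian_group (ring_of_type_algebra :: 'a ring)"
    by (rule abelian_groupI) (auto simp: algebra_simps intro: exI[of _ "- _"])
  show "Group.monoid (ring_of_type_algebra :: 'a ring)"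
    by unfold_locales (auto simp: algebra_simps)
qed (auto simp: algebra_simps)

lemma ideal_uq_ideal: "ideal (uq_ideal q) ring_of_type_algebra"
  unfolding uq_ideal_def by (rule ring.genideal_ideal[OF ring_ring_of_type_algebra]) simp

lemma ring_uq: "ring (uq q)"
  unfolding uq_def by (rule ideal.quotient_is_ring[OF ideal_uq_ideal])

lemma uq_class_ring_hom: "uq_class q \<in> ring_hom ring_of_type_algebra (uq q)"
  using ideal.rcos_ring_hom[OF ideal_uq_ideal[of q]] unfolding uq_def uq_class_def .

lemma uq_class_closed: "uq_class q p \<in> carrier (uq q)"
  using ring_hom_closed[OF uq_class_ring_hom] by simp

lemma uq_class_add: "uq_class q (p + p') = uq_class q p \<oplus>\<^bsub>uq q\<^esub> uq_class q p'"
  using ring_hom_add[OF uq_class_ring_hom[of q], of p p'] by simp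

lemma uq_class_mult: "uq_class q (p * p') = uq_class q p \<otimes>\<^bsub>uq q\<^esub> uq_class q p'"
  using ring_hom_mult[OF uq_class_ring_hom[of q], of p p'] by simp

lemma uq_class_one: "uq_class q 1 = \<one>\<^bsub>uq q\<^esub>"
  using ring_hom_one[OF uq_class_ring_hom[of q]] by simp

lemma uq_class_smult: "uq_smult q c (uq_class q p) = uq_class q (free_scalar c * p)"
  by (simp add: uq_smult_def uq_scalar_def uq_class_mult)

lemma uq_class_eqD:
  assumes "uq_class q p = uq_class q p'"
  shows "p - p' \<in> uq_ideal q"
proof -
  interpret I: ideal "uq_ideal q" ring_of_type_algebra by (rule ideal_uq_ideal)
  have "0 \<in> uq_ideal q" using additive_subgroup.zero_closed[OF I.additive_subgroup_axioms] by simp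
  then have "p \<in> uq_class q p'"
    unfolding assms[symmetric] by (auto simp: uq_class_def a_r_coset_def' intro: bexI[of _ 0])
  then show ?thesis by (auto simp: uq_class_def a_r_coset_def')
qed

lemma uq_vee_generators_closed: "range (uq_scalar q) \<union> {uq_x q, uq_yinv q, uq_z q} \<subseteq> carrier (uq q)"
  by (auto simp: uq_scalar_def uq_x_def uq_yinv_def uq_z_def uq_class_closed)

lemma subring_uq_vee: "subring (uq_vee q) (uq q)"
  unfolding uq_vee_def by (rule ring.generate_ring_is_subring[OF ring_uq uq_vee_generators_closed])

lemma uq_vee_subset_carrier: "uq_vee q \<subseteq> carrier (uq q)"
  unfolding uq_vee_def by (rule ring.generate_ring_incl[OF ring_uq uq_vee_generators_closed])

lemma uq_vee_class:
  assumes "u \<in> uq_vee q" obtains p where "u = uq_class q p"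
  using uq_vee_subset_carrier[of q] assms
  unfolding uq_def uq_class_def FactRing_def by (auto simp: A_RCOSETS_def')

lemma uq_vee_intros [intro, simp]:
  "uq_scalar q c \<in> uq_vee q" "uq_x q \<in> uq_vee q" "uq_yinv q \<in> uq_vee q" "uq_z q \<in> uq_vee q"
  by (simp_all add: uq_vee_def generate_ring.incl)

lemma uq_vee_closed:
  "\<one>\<^bsub>uq q\<^esub> \<in> uq_vee q"
  "u \<in> uq_vee q \<Longrightarrow> \<ominus>\<^bsub>uq q\<^esub> u \<in> uq_vee q"
  "u \<in> uq_vee q \<Longrightarrow> u' \<in> uq_vee q \<Longrightarrow> u \<oplus>\<^bsub>uq q\<^esub> u' \<in> uq_vee q"
  "u \<in> uq_vee q \<Longrightarrow> u' \<in> uq_vee q \<Longrightarrow> u \<otimes>\<^bsub>uq q\<^esub> u' \<in> uq_vee q"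
  "u \<in> uq_vee q \<Longrightarrow> uq_smult q c u \<in> uq_vee q"
  by (auto simp: uq_vee_def uq_smult_def intro: generate_ring.intros
      intro!: generate_ring.incl[of "uq_scalar q c"])

section \<open>Representations of the free algebra\<close>

lemma poly_mapping_eq_sum_single:
  "p = (\<Sum>m\<in>Poly_Mapping.keys p. Poly_Mapping.single m (Poly_Mapping.lookup p m))"
proof (rule poly_mapping_eqI)
  fix m
  show "Poly_Mapping.lookup p m = Poly_Mapping.lookup
      (\<Sum>m\<in>Poly_Mapping.keys p. Poly_Mapping.single m (Poly_Mapping.lookup p m)) m"
    by (cases "m \<in> Poly_Mapping.keys p")
      (simp_all add: lookup_sum lookup_single when_def in_keys_iff sum.delta)
qed

text \<open>The linear extension to the free algebra of an assignment \<open>\<rho>\<close> of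
  operators to generators. By \<open>foldr\<close> the first letter acts last, so concatenation of
  words becomes composition.\<close>

definition (in vector_space) free_action :: "('g \<Rightarrow> 'b \<Rightarrow> 'b) \<Rightarrow> ('g, 'a) free_algebra \<Rightarrow> 'b \<Rightarrow> 'b" where
  "free_action \<rho> p v = (\<Sum>m\<in>Poly_Mapping.keys p. scale (Poly_Mapping.lookup p m) (foldr \<rho> (letters m) v))"

context vector_space
begin

lemma free_action_superset:
  assumes "finite M" "Poly_Mapping.keys p \<subseteq> M"
  shows "free_action \<rho> p v = (\<Sum>m\<in>M. scale (Poly_Mapping.lookup p m) (foldr \<rho> (letters m) v))"
  unfolding free_action_def using assms
  by (intro sum.mono_neutral_left) (auto simp: in_keys_iff)

lemma free_action_zero [simp]: "free_action \<rho> 0 v = 0"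
  by (simp add: free_action_def)

lemma free_action_single [simp]:
  "free_action \<rho> (Poly_Mapping.single m c) v = scale c (foldr \<rho> (letters m) v)"
  by (subst free_action_superset[of "{m}"]) auto

lemma free_action_add: "free_action \<rho> (p + p') v = free_action \<rho> p v + free_action \<rho> p' v"
proof -
  let ?M = "Poly_Mapping.keys p \<union> Poly_Mapping.keys p'"
  have "finite ?M" "Poly_Mapping.keys (p + p') \<subseteq> ?M" by (simp_all add: Poly_Mapping.keys_add)
  then show ?thesis
    by (simp add: free_action_superset[of ?M] lookup_add scale_left_distrib sum.distrib)
qed

lemma free_action_diff: "free_action \<rho> (p - p') v = free_action \<rho> p v - free_action \<rho> p' v"
  using free_action_add[of \<rho> "p - p'" p' v] by simp

lemma free_action_sum: "free_action \<rho> (\<Sum>i\<in>I. p i) v = (\<Sum>i\<in>I. free_action \<rho> (p i) v)"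
  by (induction I rule: infinite_finite_induct) (simp_all add: free_action_add)

lemma linear_foldr:
  assumes "\<And>g. Vector_Spaces.linear scale scale (\<rho> g)"
  shows "Vector_Spaces.linear scale scale (foldr \<rho> gs)"
proof (induction gs)
  case Nil
  show ?case by unfold_locales simp_all
next
  case (Cons g gs)
  interpret g: Vector_Spaces.linear scale scale "\<rho> g" by (rule assms)
  interpret gs: Vector_Spaces.linear scale scale "foldr \<rho> gs" by fact
  show ?case by unfold_locales (simp_all add: g.add g.scale gs.add gs.scale)
qed

context
  fixes \<rho> :: "'g \<Rightarrow> 'b \<Rightarrow> 'b"
  assumes lin: "\<And>g. Vector_Spaces.linear scale scale (\<rho> g)"
begin

lemma linear_free_action: "Vector_Spaces.linear scale scale (free_action \<rho> p)"
proof -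
  have add: "foldr \<rho> gs (u + v) = foldr \<rho> gs u + foldr \<rho> gs v"
    and scl: "foldr \<rho> gs (scale c v) = scale c (foldr \<rho> gs v)" for gs u v c
  proof -
    interpret gs: Vector_Spaces.linear scale scale "foldr \<rho> gs" by (rule linear_foldr[OF lin])
    show "foldr \<rho> gs (u + v) = foldr \<rho> gs u + foldr \<rho> gs v" by (rule gs.add)
    show "foldr \<rho> gs (scale c v) = scale c (foldr \<rho> gs v)" by (rule gs.scale)
  qed
  show ?thesis
    by unfold_locales
      (simp_all add: free_action_def add scl scale_right_distrib sum.distrib scale_sum_right mult.commute)
qed

text \<open>Both sides are additive in \<open>p\<close> and in \<open>p'\<close>, so it suffices to
  compare multiples of single words, where concatenation is composition.\<close>

lemma free_action_mult: "free_action \<rho> (p * p') v = free_action \<rho> p (free_action \<rho> p' v)"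
proof -
  have single: "free_action \<rho> (Poly_Mapping.single m c * Poly_Mapping.single m' c') v =
      free_action \<rho> (Poly_Mapping.single m c) (free_action \<rho> (Poly_Mapping.single m' c') v)" for m m' c c'
  proof -
    interpret m: Vector_Spaces.linear scale scale "foldr \<rho> (letters m)" by (rule linear_foldr[OF lin])
    show ?thesis by (simp add: Poly_Mapping.mult_single plus_fword_def m.scale)
  qed
  have "p * p' = (\<Sum>m\<in>Poly_Mapping.keys p. Poly_Mapping.single m (Poly_Mapping.lookup p m)) *
      (\<Sum>m'\<in>Poly_Mapping.keys p'. Poly_Mapping.single m' (Poly_Mapping.lookup p' m'))"
    by (simp only: poly_mapping_eq_sum_single[symmetric])
  then have "free_action \<rho> (p * p') v =
    (\<Sum>m\<in>Poly_Mapping.keys p. \<Sum>m'\<in>Poly_Mapping.keys p'. free_action \<rho>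
      (Poly_Mapping.single m (Poly_Mapping.lookup p m) * Poly_Mapping.single m' (Poly_Mapping.lookup p' m')) v)"
    by (simp only: sum_product free_action_sum)
  also have "\<dots> = (\<Sum>m\<in>Poly_Mapping.keys p.
      free_action \<rho> (Poly_Mapping.single m (Poly_Mapping.lookup p m)) (free_action \<rho> p' v))"
  proof (rule sum.cong[OF refl])
    fix m
    let ?s = "free_action \<rho> (Poly_Mapping.single m (Poly_Mapping.lookup p m))"
    interpret s: Vector_Spaces.linear scale scale ?s by (rule linear_free_action)
    have "free_action \<rho> p' v = (\<Sum>m'\<in>Poly_Mapping.keys p'.
        free_action \<rho> (Poly_Mapping.single m' (Poly_Mapping.lookup p' m')) v)"
      by (subst (1) poly_mapping_eq_sum_single[of p']) (simp only: free_action_sum)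
    then show "(\<Sum>m'\<in>Poly_Mapping.keys p'. free_action \<rho>
        (Poly_Mapping.single m (Poly_Mapping.lookup p m) * Poly_Mapping.single m' (Poly_Mapping.lookup p' m')) v) =
        ?s (free_action \<rho> p' v)"
      by (simp only: single s.sum)
  qed
  also have "\<dots> = free_action \<rho> p (free_action \<rho> p' v)"
    by (subst (3) poly_mapping_eq_sum_single[of p]) (simp only: free_action_sum)
  finally show ?thesis .
qed

lemma free_action_one [simp]: "free_action \<rho> 1 v = v"
proof -
  have "free_action \<rho> (Poly_Mapping.single 0 1) v = v"
    by (simp only: free_action_single) (simp add: zero_fword_def)
  then show ?thesis by (simp only: single_one)
qed

lemma free_action_gen [simp]: "free_action \<rho> (free_gen g) v = \<rho> g v"
  by (simp add: free_gen_def)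

lemma free_action_scalar [simp]: "free_action \<rho> (free_scalar c) v = scale c v"
  by (simp add: free_scalar_def zero_fword_def)

end

text \<open>The elements acting as zero form a two-sided ideal that contains the relators.\<close>

lemma free_action_uq_ideal:
  assumes lin: "\<And>g. Vector_Spaces.linear scale scale (\<rho> g)"
    and relators: "\<And>r v. r \<in> uq_relators q \<Longrightarrow> free_action \<rho> r v = 0"
    and "p \<in> uq_ideal q"
  shows "free_action \<rho> p v = 0"
proof -
  let ?I = "{p. \<forall>v. free_action \<rho> p v = 0}"
  interpret R: ring "ring_of_type_algebra :: (uq_gen, 'a) free_algebra ring"
    by (rule ring_ring_of_type_algebra)
  have zero: "free_action \<rho> p 0 = 0" for p
  proof -
    interpret p: Vector_Spaces.linear scale scale "free_action \<rho> p" by (rule linear_free_action[OF lin])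
    show ?thesis by simp
  qed
  have minus: "\<ominus>\<^bsub>ring_of_type_algebra\<^esub> p = - p" for p :: "(uq_gen, 'a) free_algebra"
    by (rule R.minus_equality) auto
  have "ideal ?I ring_of_type_algebra"
  proof (rule idealI[OF R.ring_axioms])
    show "subgroup ?I (add_monoid ring_of_type_algebra)"
      by (rule R.add.subgroupI)
        (auto simp: minus a_inv_def[symmetric] free_action_add free_action_diff[of _ 0, simplified] intro: exI[of _ 0])
  qed (auto simp: free_action_mult[OF lin] zero)
  then have "uq_ideal q \<subseteq> ?I"
    unfolding uq_ideal_def using relators by (intro R.genideal_minimal) auto
  then show ?thesis using assms(3) by auto
qed

text \<open>An element acts through any representative; by \<open>free_action_uq_ideal\<close> the
  choice does not matter. Restricting to the subalgebra makes the action extensional.\<close>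

lemma uq_vee_module_structure_exists:
  assumes lin: "\<And>g. Vector_Spaces.linear scale scale (\<rho> g)"
    and relators: "\<And>r v. r \<in> uq_relators q \<Longrightarrow> free_action \<rho> r v = 0"
  obtains act where "uq_vee_module_structure q scale act"
    "\<And>p. uq_class q p \<in> uq_vee q \<Longrightarrow> act (uq_class q p) = free_action \<rho> p"
proof -
  define act where "act = restrict (\<lambda>u. free_action \<rho> (SOME p. uq_class q p = u)) (uq_vee q)"
  have act: "act (uq_class q p) = free_action \<rho> p" if "uq_class q p \<in> uq_vee q" for p
  proof -
    let ?p = "SOME p'. uq_class q p' = uq_class q p"
    have "uq_class q ?p = uq_class q p" by (rule someI[of _ p]) simp
    then have "free_action \<rho> (?p - p) v = 0" for v
      by (intro free_action_uq_ideal[OF lin relators uq_class_eqD]) auto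
    then show ?thesis using that by (auto simp: act_def free_action_diff)
  qed
  have "uq_vee_module_structure q scale act"
    unfolding uq_vee_module_structure_def
  proof (intro conjI ballI allI)
    show "act \<in> extensional (uq_vee q)" by (simp add: act_def)
  next
    fix u assume u: "u \<in> uq_vee q"
    obtain p where p: "u = uq_class q p" using uq_vee_class[OF u] .
    show "Vector_Spaces.linear scale scale (act u)"
      using u by (simp add: p act linear_free_action[OF lin])
    show "act (uq_smult q c u) v = scale c (act u v)" for c v
      using u uq_vee_closed(5)[OF u, of c]
      by (simp add: p act uq_class_smult free_action_mult[OF lin] free_action_scalar[OF lin])
    fix u' v assume u': "u' \<in> uq_vee q"
    obtain p' where p': "u' = uq_class q p'" using uq_vee_class[OF u'] .
    show "act (u \<oplus>\<^bsub>uq q\<^esub> u') v = act u v + act u' v"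
      using u u' uq_vee_closed(3)[OF u u']
      by (simp add: p p' act uq_class_add[symmetric] free_action_add)
    show "act (u \<otimes>\<^bsub>uq q\<^esub> u') v = act u (act u' v)"
      using u u' uq_vee_closed(4)[OF u u']
      by (simp add: p p' act uq_class_mult[symmetric] free_action_mult[OF lin])
  next
    fix v
    show "act \<one>\<^bsub>uq q\<^esub> v = v"
      using act[of 1] uq_vee_closed(1)[of q] by (simp add: uq_class_one free_action_one[OF lin])
  qed
  then show ?thesis using act that by blast
qed

text \<open>Induction over the generated subring; the scalars among its generators act in the same
  way in every module structure.\<close>

lemma uq_vee_module_structure_eqI:
  assumes act: "uq_vee_module_structure q scale act" and act': "uq_vee_module_structure q scale act'"
    and "act (uq_x q) = act' (uq_x q)" "act (uq_yinv q) = act' (uq_yinv q)" "act (uq_z q) = act' (uq_z q)"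
  shows "act = act'"
proof (rule extensionalityI)
  interpret U: ring "uq q" by (rule ring_uq)
  show "act \<in> extensional (uq_vee q)" "act' \<in> extensional (uq_vee q)"
    using act act' by (simp_all add: uq_vee_module_structure_def)
  fix u assume "u \<in> uq_vee q"
  then show "act u = act' u"
    unfolding uq_vee_def
  proof induction
    case one
    then show ?case using act act' by (simp add: uq_vee_module_structure_def fun_eq_iff)
  next
    case (incl u)
    have "uq_scalar q c = uq_smult q c \<one>\<^bsub>uq q\<^esub>" for c
      by (simp add: uq_smult_def uq_scalar_def uq_class_closed)
    then have scalar: "f (uq_scalar q c) v = scale c v" if "uq_vee_module_structure q scale f" for f c v
      using that uq_vee_closed(1)[of q] by (simp add: uq_vee_module_structure_def)
    have "act (uq_scalar q c) = act' (uq_scalar q c)" for c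
      by (simp add: fun_eq_iff scalar[OF act] scalar[OF act'])
    then show ?case using incl assms(3-) by auto
  next
    case (a_inv u)
    \<comment> \<open>The definition of a module structure does not mention negatives; additivity
      determines them once zero is known to act as zero.\<close>
    have neg: "act (\<ominus>\<^bsub>uq q\<^esub> u) v = - act u v"
      if "uq_vee_module_structure q scale act" "u \<in> uq_vee q" for act u v
    proof -
      have u: "u \<in> carrier (uq q)" using that(2) uq_vee_subset_carrier by blast
      have 0: "\<zero>\<^bsub>uq q\<^esub> \<in> uq_vee q" by (rule subringE(2)[OF subring_uq_vee])
      have "act (\<zero>\<^bsub>uq q\<^esub> \<oplus>\<^bsub>uq q\<^esub> \<zero>\<^bsub>uq q\<^esub>) v = act \<zero>\<^bsub>uq q\<^esub> v + act \<zero>\<^bsub>uq q\<^esub> v"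
        using that(1) 0 unfolding uq_vee_module_structure_def by blast
      then have "act \<zero>\<^bsub>uq q\<^esub> v = 0" by simp
      moreover have "act (\<ominus>\<^bsub>uq q\<^esub> u) v + act u v = act (\<ominus>\<^bsub>uq q\<^esub> u \<oplus>\<^bsub>uq q\<^esub> u) v"
        using that uq_vee_closed(2)[OF that(2)] by (simp add: uq_vee_module_structure_def)
      ultimately show ?thesis using u by (simp add: U.l_neg eq_neg_iff_add_eq_0)
    qed
    then show ?case using a_inv by (simp add: fun_eq_iff neg[OF act] neg[OF act'] uq_vee_def)
  next
    case (eng_add u u')
    then show ?case using act act' by (simp add: uq_vee_module_structure_def uq_vee_def fun_eq_iff)
  next
    case (eng_mult u u')
    then show ?case using act act' by (simp add: uq_vee_module_structure_def uq_vee_def fun_eq_iff)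
  qed
qed

lemma module_structure_lincomb:
  assumes "uq_vee_module_structure q scale act" "u \<in> uq_vee q" "u' \<in> uq_vee q"
  shows "act (uq_smult q c u \<oplus>\<^bsub>uq q\<^esub> uq_smult q c' u') v = scale c (act u v) + scale c' (act u' v)"
proof -
  have "act (uq_smult q c u \<oplus>\<^bsub>uq q\<^esub> uq_smult q c' u') v = act (uq_smult q c u) v + act (uq_smult q c' u') v"
    using assms uq_vee_closed(5) unfolding uq_vee_module_structure_def by blast
  then show ?thesis using assms unfolding uq_vee_module_structure_def by simp
qed

lemma
  assumes act: "uq_vee_module_structure q scale act"
  shows act_uq_X: "act (uq_X q a) v = scale (inverse (a\<^sup>2)) (act (uq_x q) v) + scale (1 - inverse (a\<^sup>2)) (act (uq_yinv q) v)"
    and act_uq_Z: "act (uq_Z q a) v = scale (a\<^sup>2) (act (uq_z q) v) + scale (1 - a\<^sup>2) (act (uq_yinv q) v)"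
    and act_uq_A: "act (uq_A q a) v = scale (inverse a) (act (uq_x q) v) + scale a (act (uq_z q) v)"
  unfolding uq_X_def uq_Z_def uq_A_def by (simp_all add: module_structure_lincomb[OF act])

text \<open>The formula for A is solved for x, and the one for Z for the inverse of y, dividing by
  \<open>a - inverse a\<close>; then X follows. This yields both uniqueness and the stated
  formulas.\<close>

lemma act_determined:
  assumes act: "uq_vee_module_structure q scale act"
    and z: "act (uq_z q) = K" and Z: "act (uq_Z q a) = B" and A: "act (uq_A q a) = A"
    and a: "a \<noteq> 0" "a\<^sup>2 \<noteq> 1"
  shows "act (uq_x q) = (\<lambda>v. scale a (A v) - scale (a\<^sup>2) (K v))"
    and "act (uq_X q a) = (\<lambda>v. scale (inverse a) (A v) - scale (inverse (a\<^sup>2)) (B v))"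
    and "act (uq_yinv q) = (\<lambda>v. scale (inverse (a - inverse a)) (scale a (K v) - scale (inverse a) (B v)))"
proof -
  have x: "act (uq_x q) v = scale a (A v) - scale (a\<^sup>2) (K v)" for v
    using a by (simp add: A[symmetric] z[symmetric] act_uq_A[OF act] scale_right_distrib power2_eq_square)
  have B: "B v = scale (a\<^sup>2) (K v) + scale (1 - a\<^sup>2) (act (uq_yinv q) v)" for v
    using act_uq_Z[OF act, of a v] by (simp add: Z z)
  have "(a - inverse a) = inverse a * (a\<^sup>2 - 1)"
    using a by (simp add: field_simps power2_eq_square)
  then have nz: "a - inverse a \<noteq> 0" using a by auto
  have y: "act (uq_yinv q) v = scale (inverse (a - inverse a)) (scale a (K v) - scale (inverse a) (B v))" for v
  proof -
    have "scale a (K v) - scale (inverse a) (B v) = scale (a - inverse a) (act (uq_yinv q) v)"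
      using a by (simp add: B algebra_simps power2_eq_square)
    then show ?thesis using nz by simp
  qed
  show "act (uq_x q) = (\<lambda>v. scale a (A v) - scale (a\<^sup>2) (K v))" by (simp add: fun_eq_iff x)
  show "act (uq_yinv q) = (\<lambda>v. scale (inverse (a - inverse a)) (scale a (K v) - scale (inverse a) (B v)))"
    by (simp add: fun_eq_iff y)
  show "act (uq_X q a) = (\<lambda>v. scale (inverse a) (A v) - scale (inverse (a\<^sup>2)) (B v))"
    using a by (simp add: fun_eq_iff act_uq_X[OF act] x B algebra_simps power2_eq_square)
qed

text \<open>Passes from the commutation rules of the operators to the normalised q-commutators in
  the relators.\<close>

lemma q_commutator_eq:
  assumes "q \<noteq> 0" "q\<^sup>2 \<noteq> 1"
    and "f = scale (inverse (q\<^sup>2)) g + scale (1 - inverse (q\<^sup>2)) v"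
  shows "scale (inverse (q - inverse q)) (scale q f - scale (inverse q) g) = v"
proof -
  have "(q - inverse q) = inverse q * (q\<^sup>2 - 1)"
    using assms by (simp add: field_simps power2_eq_square)
  then have nz: "q - inverse q \<noteq> 0" using assms by auto
  have qq: "q * (inverse q * inverse q) = inverse q" using assms(1) by simp
  have "scale q f - scale (inverse q) g = scale (q - inverse q) v"
    using assms(1) by (simp add: assms(3) qq algebra_simps power2_eq_square)
  then show ?thesis using nz by simp
qed

end

section \<open>The module structure on the given space\<close>

context q_racah_split
begin

definition y :: "'v \<Rightarrow> 'v" where "y = inv_into UNIV w"

lemma w_y: "w (y v) = v" and y_w: "y (w v) = v"
  using bij_w by (simp_all add: y_def bij_def surj_f_inv_f)

lemma linear_y: "Vector_Spaces.linear scale scale y"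
proof -
  interpret w: Vector_Spaces.linear scale scale w by (rule linear_w)
  show ?thesis
  proof unfold_locales
    fix u v
    have "y (w (y u + y v)) = y u + y v" by (rule y_w)
    then show "y (u + v) = y u + y v" by (simp add: w.add w_y)
  next
    fix c v
    have "y (w (scale c (y v))) = scale c (y v)" by (rule y_w)
    then show "y (scale c v) = scale c (y v)" by (simp add: w.scale w_y)
  qed
qed

text \<open>The space becomes a module for the whole algebra, with y acting as the inverse of
  \<open>w\<close>; the action is then restricted to the subalgebra.\<close>

lemma uq_vee_module_exists:
  assumes "q\<^sup>2 \<noteq> 1"
  obtains act where "uq_vee_module_structure q scale act"
    "act (uq_z q) = K" "act (uq_Z q a) = B" "act (uq_A q a) = A"
proof -
  define \<rho> where "\<rho> g = (case g of Gx \<Rightarrow> x | Gy \<Rightarrow> y | Gyinv \<Rightarrow> w | Gz \<Rightarrow> K)" for g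
  have \<rho>: "\<rho> Gx = x" "\<rho> Gy = y" "\<rho> Gyinv = w" "\<rho> Gz = K" by (simp_all add: \<rho>_def)
  have lin: "Vector_Spaces.linear scale scale (\<rho> g)" for g
    by (cases g) (simp_all add: \<rho> linear_x linear_y linear_w linear_K)
  note action = free_action_mult[OF lin] free_action_gen[OF lin] free_action_scalar[OF lin]
    free_action_one[OF lin] free_action_diff \<rho>
  interpret w: Vector_Spaces.linear scale scale w by (rule linear_w)
  interpret y: Vector_Spaces.linear scale scale "y" by (rule linear_y)
  \<comment> \<open>Multiplying \<open>w_x\<close> by \<open>y\<close> on both sides removes every
    \<open>w\<close>; the next relation arises from \<open>K_w\<close> in the same way.\<close>
  have xy: "x (y v) = scale p (y (x v)) + scale (1 - p) v" for v
  proof -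
    have "y (w (x (y v))) = scale p (y (x v)) + scale (1 - p) v"
      by (simp only: w_x y.add y.scale w_y y_w)
    then show ?thesis by (simp only: y_w)
  qed
  have yz: "y (K v) = scale p (K (y v)) + scale (1 - p) v" for v
  proof -
    have "y (K (w (y v))) = scale p (K (y v)) + scale (1 - p) v"
      by (subst K_w) (simp only: y.add y.scale w_y y_w)
    then show ?thesis by (simp only: w_y)
  qed
  note comm = q_commutator_eq[OF q_nonzero assms xy[unfolded p_def]]
    q_commutator_eq[OF q_nonzero assms yz[unfolded p_def]]
    q_commutator_eq[OF q_nonzero assms K_x[unfolded p_def]]
  have relators: "free_action \<rho> r v = 0" if "r \<in> uq_relators q" for r v
    using that unfolding uq_relators_def Let_def
    by (elim insertE emptyE) (simp_all only: action w_y y_w comm diff_self)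
  obtain act where act: "uq_vee_module_structure q scale act"
    "\<And>p. uq_class q p \<in> uq_vee q \<Longrightarrow> act (uq_class q p) = free_action \<rho> p"
    using uq_vee_module_structure_exists[OF lin relators] by blast
  have gens: "act (uq_x q) v = x v" "act (uq_yinv q) v = w v" "act (uq_z q) v = K v" for v
    using uq_vee_intros[of q] act(2) unfolding uq_x_def uq_yinv_def uq_z_def by (simp_all add: action)
  show ?thesis
  proof (rule that[OF act(1)])
    show "act (uq_z q) = K" by (simp add: fun_eq_iff gens)
    show "act (uq_Z q a) = B" by (simp add: fun_eq_iff act_uq_Z[OF act(1)] gens B_eq)
    show "act (uq_A q a) = A"
      using a_nonzero by (simp add: fun_eq_iff act_uq_A[OF act(1)] gens x_def scale_right_diff_distrib power2_eq_square)
  qed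
qed

end

text \<open>A basis of eigenvectors has nonzero members, so their eigenspaces occur among the
  \<open>V i\<close>; these are listed without repetition, so the eigenvalues are distinct.\<close>

lemma eigenspace_decompositionI:
  assumes lin: "Vector_Spaces.linear scale scale A"
    and diag: "diagonalizable scale A"
    and bij: "bij_betw V {0..d} (eigenspaces scale A)"
    and V: "\<And>i. i \<le> d \<Longrightarrow> V i = eigenspace scale A (\<theta> i)"
  shows "eigenspace_decomposition scale A d V \<theta>"
proof -
  interpret A: Vector_Spaces.linear scale scale A by fact
  have inj: "inj_on \<theta> {0..d}"
  proof (rule inj_onI)
    fix i j assume "i \<in> {0..d}" "j \<in> {0..d}" "\<theta> i = \<theta> j"
    then show "i = j" using bij V[of i] V[of j] by (auto simp: bij_betw_def inj_on_def)
  qed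
  obtain Bs where Bs: "\<not> A.vs1.dependent Bs" "A.vs1.span Bs = UNIV" "\<And>v. v \<in> Bs \<Longrightarrow> \<exists>t. A v = scale t v"
    using diag unfolding diagonalizable_def by auto
  have "Bs \<subseteq> (\<Union>i\<in>{0..d}. V i)"
  proof
    fix v assume v: "v \<in> Bs"
    then obtain t where t: "A v = scale t v" using Bs(3) by blast
    have "v \<noteq> 0" using v Bs(1) A.vs1.dependent_zero by blast
    then have "eigenspace scale A t \<in> eigenspaces scale A"
      using t by (auto simp: eigenspaces_def eigenspace_def)
    then have "eigenspace scale A t \<in> V ` {0..d}" using bij by (simp add: bij_betw_def)
    then show "v \<in> (\<Union>i\<in>{0..d}. V i)" using t by (auto simp: eigenspace_def)
  qed
  then have "subspace_sum scale V {0..d} = UNIV"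
    using A.vs1.span_mono Bs(2) unfolding subspace_sum_def by blast
  then show ?thesis using inj V by unfold_locales auto
qed

theorem theorem12p5:
  fixes scale :: "'f::field \<Rightarrow> 'v::ab_group_add \<Rightarrow> 'v"
    and Basis :: "'v set"
    and q a b :: 'f
    and A As K B :: "'v \<Rightarrow> 'v"
    and d :: nat
    and V Vs :: "nat \<Rightarrow> 'v set"
    and \<theta> \<theta>s :: "nat \<Rightarrow> 'f"
  assumes q: "q \<noteq> 0" "q ^ 4 \<noteq> 1"
    and fin_dim: "finite_dimensional_vector_space scale Basis"
    and dim_pos: "vector_space.dim scale (UNIV :: 'v set) > 0"
    and td_pair: "tridiagonal_pair scale A As"
    and d: "d \<ge> 1"
    and ordering: "tridiagonal_ordering scale A As d V"
    and dual_ordering: "tridiagonal_ordering scale As A d Vs"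
    and eigenvalues: "\<forall>i\<le>d. V i = eigenspace scale A (\<theta> i)"
    and dual_eigenvalues: "\<forall>i\<le>d. Vs i = eigenspace scale As (\<theta>s i)"
    and ab: "a \<noteq> 0" "b \<noteq> 0"
    and q_Racah: "\<forall>i\<le>d. \<theta> i = a * q powi (int d - 2 * int i) + inverse a * q powi (2 * int i - int d)"
    and dual_q_Racah: "\<forall>i\<le>d. \<theta>s i = b * q powi (int d - 2 * int i) + inverse b * q powi (2 * int i - int d)"
    and K_linear: "Vector_Spaces.linear scale scale K"
    and K: "\<forall>i\<le>d. \<forall>v\<in>split_U scale d V Vs i. K v = scale (q powi (int d - 2 * int i)) v"
    and B_linear: "Vector_Spaces.linear scale scale B"
    and B: "\<forall>i\<le>d. \<forall>v\<in>split_U_down scale d V Vs i. B v = scale (q powi (int d - 2 * int i)) v"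
  shows
    "(\<exists>!act. uq_vee_module_structure q scale act \<and>
        act (uq_z q) = K \<and> act (uq_Z q a) = B \<and> act (uq_A q a) = A) \<and>
     (\<forall>act. uq_vee_module_structure q scale act \<and>
        act (uq_z q) = K \<and> act (uq_Z q a) = B \<and> act (uq_A q a) = A \<longrightarrow>
        act (uq_x q) = (\<lambda>v. scale a (A v) - scale (a^2) (K v)) \<and>
        act (uq_X q a) = (\<lambda>v. scale (inverse a) (A v) - scale (inverse (a^2)) (B v)) \<and>
        act (uq_yinv q) =
          (\<lambda>v. scale (inverse (a - inverse a)) (scale a (K v) - scale (inverse a) (B v))))"
proof -
  interpret fd: finite_dimensional_vector_space scale Basis by (rule fin_dim)
  have lin: "Vector_Spaces.linear scale scale A" "Vector_Spaces.linear scale scale As"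
    and diag: "diagonalizable scale A" "diagonalizable scale As"
    and irr: "\<And>S. fd.subspace S \<Longrightarrow> A ` S \<subseteq> S \<Longrightarrow> As ` S \<subseteq> S \<Longrightarrow> S = {0} \<or> S = UNIV"
    using td_pair unfolding tridiagonal_pair_def by blast+
  have bij: "bij_betw V {0..d} (eigenspaces scale A)" "bij_betw Vs {0..d} (eigenspaces scale As)"
    using ordering dual_ordering by (simp_all add: tridiagonal_ordering_def)
  interpret E: eigenspace_decomposition scale A d V \<theta>
    using lin diag bij eigenvalues by (intro eigenspace_decompositionI) auto
  interpret Es: eigenspace_decomposition scale As d Vs \<theta>s
    using lin diag bij dual_eigenvalues by (intro eigenspace_decompositionI) auto
  interpret td_split scale Basis A As d V Vs \<theta> \<theta>s
  proof unfold_locales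
    fix i assume i: "i \<le> d"
    have "V i \<in> eigenspaces scale A" "Vs i \<in> eigenspaces scale As"
      using i bij by (auto simp: bij_betw_def)
    then show "V i \<noteq> {0}" "Vs i \<noteq> {0}" by (auto simp: eigenspaces_def)
    show "As v \<in> subspace_sum scale V {j. j \<le> d \<and> i \<le> j + 1 \<and> j \<le> i + 1}" if "v \<in> V i" for v
      using ordering i that by (auto simp: tridiagonal_ordering_def)
    show "A v \<in> subspace_sum scale Vs {j. j \<le> d \<and> i \<le> j + 1 \<and> j \<le> i + 1}" if "v \<in> Vs i" for v
      using dual_ordering i that by (auto simp: tridiagonal_ordering_def)
  qed (rule irr)
  \<comment> \<open>Otherwise \<open>a\<close> is its own inverse and the eigenvalue formula is
    symmetric under exchanging \<open>i\<close> with \<open>d - i\<close>, so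
    \<open>\<theta> 0 = \<theta> d\<close> although \<open>d \<ge> 1\<close>.\<close>
  have a_square: "a\<^sup>2 \<noteq> 1"
  proof
    assume "a\<^sup>2 = 1"
    then have "inverse a = a" using ab by (simp add: field_simps power2_eq_square)
    then have "\<theta> 0 = \<theta> d" using q_Racah by (simp add: algebra_simps)
    then show False using inj_onD[OF E.inj_eigenvalues, of 0 d] d by simp
  qed
  have "q\<^sup>2 \<noteq> 1"
  proof
    assume "q\<^sup>2 = 1"
    then have "(q\<^sup>2)\<^sup>2 = 1" by simp
    then show False using q(2) by simp
  qed
  have intervals: "{..<Suc i} = {0..i}" "i \<le> d \<Longrightarrow> {..<Suc d - i} = {0..d - i}" for i by auto
  interpret q_racah_split scale Basis A As d V Vs \<theta> \<theta>s q a K B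
  proof (intro q_racah_split.intro q_racah_split_axioms.intro)
    show "td_split scale Basis A As d V Vs \<theta> \<theta>s" by (rule td_split_axioms)
    fix i v assume i: "i \<le> d"
    show "K v = scale (q powi (int d - 2 * int i)) v" if "v \<in> U i"
      using K i that by (simp add: U_def W_def C_def split_U_def intervals)
    show "B v = scale (q powi (int d - 2 * int i)) v" if "v \<in> U_down i"
      using B i that by (simp add: U_down_def W_def split_U_down_def intervals del: lessThan_Suc)
    show "\<theta> i = a * q powi (int d - 2 * int i) + inverse a * q powi (2 * int i - int d)"
      using q_Racah i by simp
  qed (use q ab a_square K_linear B_linear in auto)
  obtain act where act: "uq_vee_module_structure q scale act"
    "act (uq_z q) = K" "act (uq_Z q a) = B" "act (uq_A q a) = A"
    using uq_vee_module_exists[OF \<open>q\<^sup>2 \<noteq> 1\<close>] .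
  show ?thesis
  proof (intro conjI ex1I[of _ act] allI impI)
    fix act' assume act': "uq_vee_module_structure q scale act' \<and>
      act' (uq_z q) = K \<and> act' (uq_Z q a) = B \<and> act' (uq_A q a) = A"
    then show "act' = act"
      using act fd.act_determined[of q act K a B A] fd.act_determined[of q act' K a B A] ab(1) a_square
      by (intro fd.uq_vee_module_structure_eqI[of q act' act]) auto
  qed (use act fd.act_determined ab(1) a_square in auto)
qed

end
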